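(* Let $\mathcal{G}$ be a finite groupoid and $K$ a field. The groupoid algebra $K\mathcal{G}^{BR}$ of the Birget-Rhodes expansion $\mathcal{G}^{BR}$ of $\mathcal{G}$ is isomorphic, as a $K$-algebra, to the partial groupoid algebra $K_{\text{par}}(\mathcal{G})$.
   Context: A groupoid $\mathcal{G}$ is a small category in which every morphism is an isomorphism; it is identified with its set of morphisms, and its set of objects $\mathcal{G}_0$ is regarded as a subset of $\mathcal{G}$ via identity morphisms. For $g \in \mathcal{G}$, the domain and range are $d(g) = g^{-1}g$ and $r(g) = gg^{-1}$ (elements of $\mathcal{G}_0$). The product $gh$ is defined exactly when $d(g) = r(h)$, and $\mathcal{G}_2 = \{(g,h) \in \mathcal{G}\times\mathcal{G} : gh \text{ is defined}\}$. All algebras are associative and unital. The partial groupoid algebra $K_{\text{par}}(\mathcal{G})$ is the universal $K$-algebra with unit generated by the set of symbols $\{[g] : g \in \mathcal{G}\}$ subject to the relations: (i) $[g^{-1}][g][h] = [g^{-1}][gh]$ for all $(g,h) \in \mathcal{G}_2$; (ii) $[g][h][h^{-1}] = [gh][h^{-1}]$ for all $(g,h) \in \mathcal{G}_2$; (iii) $[r(g)][g] = [g] = [g][d(g)]$ for all $g \in \mathcal{G}$; (iv) $[g][h] = 0$ for all $(g,h) \in (\mathcal{G}\times\mathcal{G}) \setminus \mathcal{G}_2$; its unit is $1_{K_{\text{par}}(\mathcal{G})} = \sum_{e \in \mathcal{G}_0}[e]$. (That is, $K_{\text{par}}(\mathcal{G})$ is the quotient of the free unital associative $K$-algebra on the symbols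 $[g]$ by the relations (i)--(iv) together with $\sum_{e \in \mathcal{G}_0}[e] = 1$.) For $g \in \mathcal{G}$ let $Y_g = \{h \in \mathcal{G} : r(h) = d(g)\}$. The Birget-Rhodes expansion of $\mathcal{G}$ is the finite groupoid $$\mathcal{G}^{BR} = \{(A,g) : g \in \mathcal{G},\ A \subseteq Y_g,\ d(g) \in A,\ g^{-1} \in A\},$$ with partial multiplication $(A,g)\cdot(B,h) = (B,gh)$ if $(g,h) \in \mathcal{G}_2$ and $A = hB := \{hb : b \in B\}$, and undefined otherwise. The inverse of $(A,g)$ is $(gA,g^{-1})$, with $d(A,g) = (A,d(g))$ and $r(A,g) = (gA,r(g))$. The groupoid algebra $K\mathcal{G}^{BR}$ is the $K$-vector space with basis $\mathcal{G}^{BR}$, where the product of two basis elements is their product in $\mathcal{G}^{BR}$ if it is defined and $0$ otherwise; its unit is the sum of all $(A,e) \in \mathcal{G}^{BR}$ with $e \in \mathcal{G}_0$. *)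

theory Defs
  imports "HOL-Algebra.QuotRing" "HOL-Algebra.Module"
begin

section \<open>Groupoids\<close>

text \<open>
  A category is given by its set of morphisms; an object is the same thing as its identity
  morphism, so \<open>dm\<close> and \<open>rn\<close> send a morphism to the identities of its domain and range.
  The product \<open>g \<cdot> h\<close> is meaningful only if \<open>dm g = rn h\<close>; its value elsewhere is arbitrary.
\<close>

record 'g precategory =
  arrows :: "'g set"
  dm :: "'g \<Rightarrow> 'g"
  rn :: "'g \<Rightarrow> 'g"
  gmult :: "'g \<Rightarrow> 'g \<Rightarrow> 'g" (infixl \<open>\<cdot>\<index>\<close> 70)

definition objects :: "('g, 'm) precategory_scheme \<Rightarrow> 'g set" where
  "objects G = {e \<in> arrows G. dm G e = e}"

definition composable :: "('g, 'm) precategory_scheme \<Rightarrow> ('g \<times> 'g) set" where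
  "composable G = {(g, h). g \<in> arrows G \<and> h \<in> arrows G \<and> dm G g = rn G h}"

locale small_category =
  fixes G (structure)
  assumes dm_closed: "g \<in> arrows G \<Longrightarrow> dm G g \<in> arrows G"
    and rn_closed: "g \<in> arrows G \<Longrightarrow> rn G g \<in> arrows G"
    and dm_dm: "g \<in> arrows G \<Longrightarrow> dm G (dm G g) = dm G g"
    and rn_dm: "g \<in> arrows G \<Longrightarrow> rn G (dm G g) = dm G g"
    and dm_rn: "g \<in> arrows G \<Longrightarrow> dm G (rn G g) = rn G g"
    and rn_rn: "g \<in> arrows G \<Longrightarrow> rn G (rn G g) = rn G g"
    and gmult_closed: "(g, h) \<in> composable G \<Longrightarrow> g \<cdot> h \<in> arrows G"
    and dm_gmult: "(g, h) \<in> composable G \<Longrightarrow> dm G (g \<cdot> h) = dm G h"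
    and rn_gmult: "(g, h) \<in> composable G \<Longrightarrow> rn G (g \<cdot> h) = rn G g"
    and right_id: "g \<in> arrows G \<Longrightarrow> g \<cdot> dm G g = g"
    and left_id: "g \<in> arrows G \<Longrightarrow> rn G g \<cdot> g = g"
    and gmult_assoc: "(g, h) \<in> composable G \<Longrightarrow> (h, k) \<in> composable G \<Longrightarrow>
      (g \<cdot> h) \<cdot> k = g \<cdot> (h \<cdot> k)"

definition is_ginv :: "('g, 'm) precategory_scheme \<Rightarrow> 'g \<Rightarrow> 'g \<Rightarrow> bool" where
  "is_ginv G g h \<longleftrightarrow> h \<in> arrows G \<and> dm G h = rn G g \<and> rn G h = dm G g \<and>
     gmult G h g = dm G g \<and> gmult G g h = rn G g"

definition ginv :: "('g, 'm) precategory_scheme \<Rightarrow> 'g \<Rightarrow> 'g" where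
  "ginv G g = (THE h. is_ginv G g h)"

locale groupoid = small_category +
  assumes ex_ginv: "g \<in> arrows G \<Longrightarrow> \<exists>h. is_ginv G g h"

lemma (in groupoid) is_ginv_ginv:
  assumes "g \<in> arrows G"
  shows "is_ginv G g (ginv G g)"
proof -
  obtain h where h: "is_ginv G g h" using ex_ginv[OF assms] by blast
  have "h' = h" if h': "is_ginv G g h'" for h'
  proof -
    have c: "(h', g) \<in> composable G" "(g, h) \<in> composable G"
      using h h' assms by (auto simp: is_ginv_def composable_def)
    have "h' = h' \<cdot> (g \<cdot> h)"
      using h h' right_id by (metis is_ginv_def)
    also have "\<dots> = (h' \<cdot> g) \<cdot> h" using gmult_assoc[OF c] by simp
    also have "\<dots> = h" using h h' left_id by (metis is_ginv_def)
    finally show ?thesis .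
  qed
  then show ?thesis unfolding ginv_def using h by (metis theI)
qed

lemma (in groupoid)
  assumes "g \<in> arrows G"
  shows ginv_closed: "ginv G g \<in> arrows G"
    and dm_ginv: "dm G (ginv G g) = rn G g"
    and rn_ginv: "rn G (ginv G g) = dm G g"
    and ginv_gmult: "ginv G g \<cdot> g = dm G g"
    and gmult_ginv: "g \<cdot> ginv G g = rn G g"
  using is_ginv_ginv[OF assms] by (auto simp: is_ginv_def)


section \<open>The Birget-Rhodes expansion\<close>

definition arrows_into_dm :: "('g, 'm) precategory_scheme \<Rightarrow> 'g \<Rightarrow> 'g set" where
  "arrows_into_dm G g = {h \<in> arrows G. rn G h = dm G g}"

text \<open>
  \<open>(A, g) \<cdot> (B, h)\<close> is defined iff \<open>dm (A, g) = (A, dm g)\<close> equals \<open>rn (B, h) = (h B, rn h)\<close>,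
  i.e. iff \<open>A = h B\<close> and \<open>(g, h)\<close> is composable.
\<close>

definition birget_rhodes ::
    "('g, 'm) precategory_scheme \<Rightarrow> ('g set \<times> 'g) precategory" where
  "birget_rhodes G =
    \<lparr> arrows = {(A, g). g \<in> arrows G \<and> A \<subseteq> arrows_into_dm G g \<and> dm G g \<in> A \<and> ginv G g \<in> A},
      dm = (\<lambda>(A, g). (A, dm G g)),
      rn = (\<lambda>(A, g). (gmult G g ` A, rn G g)),
      gmult = (\<lambda>(A, g) (B, h). (B, gmult G g h)) \<rparr>"


section \<open>Algebras over a field\<close>

text \<open>The library locale \<open>algebra\<close> is restricted to commutative algebras.\<close>

locale assoc_algebra = module + M?: ring M +
  assumes smult_mult_left:
      "\<lbrakk>a \<in> carrier R; x \<in> carrier M; y \<in> carrier M\<rbrakk> \<Longrightarrow>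
        (a \<odot>\<^bsub>M\<^esub> x) \<otimes>\<^bsub>M\<^esub> y = a \<odot>\<^bsub>M\<^esub> (x \<otimes>\<^bsub>M\<^esub> y)"
    and smult_mult_right:
      "\<lbrakk>a \<in> carrier R; x \<in> carrier M; y \<in> carrier M\<rbrakk> \<Longrightarrow>
        x \<otimes>\<^bsub>M\<^esub> (a \<odot>\<^bsub>M\<^esub> y) = a \<odot>\<^bsub>M\<^esub> (x \<otimes>\<^bsub>M\<^esub> y)"

definition algebra_isomorphic ::
    "('k, 'm) ring_scheme \<Rightarrow> ('k, 'a, 'n) module_scheme \<Rightarrow> ('k, 'b, 'p) module_scheme \<Rightarrow> bool"
  where
  "algebra_isomorphic K A B \<longleftrightarrow>
    (\<exists>\<phi> \<in> ring_iso A B. \<forall>c \<in> carrier K. \<forall>a \<in> carrier A. \<phi> (c \<odot>\<^bsub>A\<^esub> a) = c \<odot>\<^bsub>B\<^esub> \<phi> a)"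

text \<open>
  The algebra with \<open>K\<close>-basis \<open>S\<close> in which the product of basis elements \<open>y\<close>, \<open>z\<close> is the basis
  element \<open>x\<close> if \<open>p y z = Some x\<close>, and \<open>0\<close> if \<open>p y z = None\<close>; its unit is the sum of the
  elements of \<open>U\<close>.  A linear combination is represented by its coefficient function, which
  vanishes outside a finite subset of \<open>S\<close>.
\<close>

definition supp :: "('k, 'm) ring_scheme \<Rightarrow> ('s \<Rightarrow> 'k) \<Rightarrow> 's set" where
  "supp K f = {x. f x \<noteq> \<zero>\<^bsub>K\<^esub>}"

definition basis_algebra ::
    "('k, 'm) ring_scheme \<Rightarrow> 's set \<Rightarrow> ('s \<Rightarrow> 's \<Rightarrow> 's option) \<Rightarrow> 's set \<Rightarrow> ('k, 's \<Rightarrow> 'k) module"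
  where
  "basis_algebra K S p U =
    \<lparr> carrier = {f. range f \<subseteq> carrier K \<and> finite (supp K f) \<and> supp K f \<subseteq> S},
      mult = (\<lambda>f g x. \<Oplus>\<^bsub>K\<^esub>y\<in>supp K f. \<Oplus>\<^bsub>K\<^esub>z\<in>supp K g.
                (if p y z = Some x then f y \<otimes>\<^bsub>K\<^esub> g z else \<zero>\<^bsub>K\<^esub>)),
      one = (\<lambda>x. if x \<in> U then \<one>\<^bsub>K\<^esub> else \<zero>\<^bsub>K\<^esub>),
      zero = (\<lambda>x. \<zero>\<^bsub>K\<^esub>),
      add = (\<lambda>f g x. f x \<oplus>\<^bsub>K\<^esub> g x),
      smult = (\<lambda>c f x. c \<otimes>\<^bsub>K\<^esub> f x) \<rparr>"

definition basis_vector :: "('k, 'm) ring_scheme \<Rightarrow> 's \<Rightarrow> 's \<Rightarrow> 'k" where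
  "basis_vector K s = (\<lambda>x. if x = s then \<one>\<^bsub>K\<^esub> else \<zero>\<^bsub>K\<^esub>)"

definition groupoid_algebra ::
    "('k, 'm) ring_scheme \<Rightarrow> ('g, 'n) precategory_scheme \<Rightarrow> ('k, 'g \<Rightarrow> 'k) module" where
  "groupoid_algebra K G =
    basis_algebra K (arrows G)
      (\<lambda>g h. if dm G g = rn G h then Some (gmult G g h) else None) (objects G)"

definition free_algebra ::
    "('k, 'm) ring_scheme \<Rightarrow> 'a set \<Rightarrow> ('k, 'a list \<Rightarrow> 'k) module" where
  "free_algebra K X = basis_algebra K (lists X) (\<lambda>v w. Some (v @ w)) {[]}"

text \<open>
  The quotient of an algebra by a two-sided ideal: the quotient ring \<open>A Quot I\<close> with
  scalars acting on cosets by \<open>c (I + a) = I + c a\<close>.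
\<close>

definition quot_algebra ::
    "('k, 'a, 'n) module_scheme \<Rightarrow> 'a set \<Rightarrow> ('k, 'a set) module" where
  "quot_algebra A I =
    \<lparr> carrier = carrier (A Quot I), mult = mult (A Quot I), one = one (A Quot I),
      zero = zero (A Quot I), add = add (A Quot I),
      smult = (\<lambda>c X. \<Union>a\<in>X. I +>\<^bsub>A\<^esub> (c \<odot>\<^bsub>A\<^esub> a)) \<rparr>"


section \<open>The partial groupoid algebra\<close>

text \<open>A relation \<open>u = v\<close> is represented by the element \<open>u - v\<close> of the free algebra.\<close>

definition par_relators ::
    "('k, 'm) ring_scheme \<Rightarrow> ('g, 'n) precategory_scheme \<Rightarrow> ('g list \<Rightarrow> 'k) set" where
  "par_relators K G =
    (let F = free_algebra K (arrows G);
         b = (\<lambda>g. basis_vector K [g])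
     in {b (ginv G g) \<otimes>\<^bsub>F\<^esub> b g \<otimes>\<^bsub>F\<^esub> b h \<ominus>\<^bsub>F\<^esub> b (ginv G g) \<otimes>\<^bsub>F\<^esub> b (gmult G g h) | g h.
           (g, h) \<in> composable G}
      \<union> {b g \<otimes>\<^bsub>F\<^esub> b h \<otimes>\<^bsub>F\<^esub> b (ginv G h) \<ominus>\<^bsub>F\<^esub> b (gmult G g h) \<otimes>\<^bsub>F\<^esub> b (ginv G h) | g h.
           (g, h) \<in> composable G}
      \<union> {b (rn G g) \<otimes>\<^bsub>F\<^esub> b g \<ominus>\<^bsub>F\<^esub> b g | g. g \<in> arrows G}
      \<union> {b g \<otimes>\<^bsub>F\<^esub> b (dm G g) \<ominus>\<^bsub>F\<^esub> b g | g. g \<in> arrows G}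
      \<union> {b g \<otimes>\<^bsub>F\<^esub> b h | g h. (g, h) \<in> (arrows G \<times> arrows G) - composable G}
      \<union> {(\<Oplus>\<^bsub>F\<^esub>e\<in>objects G. b e) \<ominus>\<^bsub>F\<^esub> \<one>\<^bsub>F\<^esub>})"

definition partial_groupoid_algebra ::
    "('k, 'm) ring_scheme \<Rightarrow> ('g, 'n) precategory_scheme \<Rightarrow> ('k, ('g list \<Rightarrow> 'k) set) module" where
  "partial_groupoid_algebra K G =
    (let F = free_algebra K (arrows G)
     in quot_algebra F (Idl\<^bsub>F\<^esub> (par_relators K G)))"


section \<open>The constructions yield groupoids and algebras\<close>

lemma (in groupoid) ginv_unique: "is_ginv G g h \<Longrightarrow> g \<in> arrows G \<Longrightarrow> ginv G g = h"
proof -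
  assume h: "is_ginv G g h" and g: "g \<in> arrows G"
  note h' = is_ginv_ginv[OF g]
  have c: "(ginv G g, g) \<in> composable G" "(g, h) \<in> composable G"
    using h h' g by (auto simp: is_ginv_def composable_def)
  have "ginv G g = ginv G g \<cdot> (g \<cdot> h)"
    using h h' right_id by (metis is_ginv_def)
  also have "\<dots> = (ginv G g \<cdot> g) \<cdot> h" using gmult_assoc[OF c] by simp
  also have "\<dots> = h" using h h' left_id by (metis is_ginv_def)
  finally show ?thesis .
qed

lemma (in groupoid) ginv_ginv:
  assumes g: "g \<in> arrows G" shows "ginv G (ginv G g) = g"
  by (rule ginv_unique)
     (use g is_ginv_ginv[OF g] in \<open>auto simp: is_ginv_def dm_closed rn_closed\<close>)

lemma (in groupoid) ginv_mult:
  assumes "(g, h) \<in> composable G"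
  shows "ginv G (g \<cdot> h) = ginv G h \<cdot> ginv G g"
proof (rule ginv_unique)
  have gh: "g \<in> arrows G" "h \<in> arrows G" "dm G g = rn G h"
    using assms by (auto simp: composable_def)
  note i = ginv_closed dm_ginv rn_ginv ginv_gmult gmult_ginv dm_gmult rn_gmult gmult_closed
  have C: "(a, b) \<in> composable G \<longleftrightarrow> a \<in> arrows G \<and> b \<in> arrows G \<and> dm G a = rn G b" for a b
    by (auto simp: composable_def)
  have "(ginv G h \<cdot> ginv G g) \<cdot> (g \<cdot> h) = ginv G h \<cdot> (ginv G g \<cdot> (g \<cdot> h))"
    by (rule gmult_assoc) (simp_all add: C gh i)
  also have "ginv G g \<cdot> (g \<cdot> h) = (ginv G g \<cdot> g) \<cdot> h"
    by (rule gmult_assoc[symmetric]) (simp_all add: C gh i)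
  finally have 1: "(ginv G h \<cdot> ginv G g) \<cdot> (g \<cdot> h) = dm G h" 
    by (simp add: gh i left_id)
  have "(g \<cdot> h) \<cdot> (ginv G h \<cdot> ginv G g) = g \<cdot> (h \<cdot> (ginv G h \<cdot> ginv G g))"
    by (rule gmult_assoc) (simp_all add: C gh i)
  also have "h \<cdot> (ginv G h \<cdot> ginv G g) = (h \<cdot> ginv G h) \<cdot> ginv G g"
    by (rule gmult_assoc[symmetric]) (simp_all add: C gh i)
  also have "\<dots> = ginv G g"
    using left_id[OF ginv_closed[OF gh(1)]] by (simp add: gh i)
  finally have 2: "(g \<cdot> h) \<cdot> (ginv G h \<cdot> ginv G g) = rn G g" 
    by (simp add: gh i)
  show "is_ginv G (g \<cdot> h) (ginv G h \<cdot> ginv G g)"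
    using 1 2 by (simp add: is_ginv_def C gh i)
  show "g \<cdot> h \<in> arrows G" by (simp add: C gh i)
qed

lemma (in groupoid) dm_eq_ginv_gmult:
  "g \<in> arrows G \<Longrightarrow> dm G g = ginv G g \<cdot> g"
  "g \<in> arrows G \<Longrightarrow> rn G g = g \<cdot> ginv G g"
  by (simp_all add: ginv_gmult gmult_ginv)

lemma (in groupoid) ginv_dm: "g \<in> arrows G \<Longrightarrow> ginv G (dm G g) = dm G g"
  by (rule ginv_unique) (use right_id[of "dm G g"] in \<open>simp_all add: is_ginv_def dm_closed dm_dm rn_dm\<close>)

lemma (in groupoid) ginv_rn: "g \<in> arrows G \<Longrightarrow> ginv G (rn G g) = rn G g"
  by (metis ginv_dm dm_rn rn_closed)

lemma (in groupoid) image_gmult_image: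
  assumes "(g, h) \<in> composable G" "A \<subseteq> arrows_into_dm G h"
  shows "gmult G (g \<cdot> h) ` A = gmult G g ` gmult G h ` A"
proof -
  have "(g \<cdot> h) \<cdot> a = g \<cdot> (h \<cdot> a)" if "a \<in> A" for a
    by (rule gmult_assoc) (use assms that in \<open>auto simp: composable_def arrows_into_dm_def\<close>)
  then show ?thesis by (auto simp: image_image)
qed

lemma (in groupoid) image_dm:
  assumes "g \<in> arrows G" "A \<subseteq> arrows_into_dm G g"
  shows "gmult G (dm G g) ` A = A"
proof -
  have "dm G g \<cdot> a = a" if "a \<in> A" for a
    using assms that left_id[of a] by (auto simp: arrows_into_dm_def)
  then show ?thesis by auto
qed

theorem (in groupoid) birget_rhodes_groupoid: "groupoid (birget_rhodes G)"
proof -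
  let ?B = "birget_rhodes G"
  have C: "(a, b) \<in> composable G \<longleftrightarrow> a \<in> arrows G \<and> b \<in> arrows G \<and> dm G a = rn G b" for a b
    by (auto simp: composable_def)
  note i = ginv_closed dm_ginv rn_ginv ginv_gmult gmult_ginv dm_gmult rn_gmult gmult_closed
    dm_closed rn_closed dm_dm rn_dm dm_rn rn_rn right_id left_id ginv_dm ginv_rn
  have arr: "(A, g) \<in> arrows ?B \<longleftrightarrow> g \<in> arrows G \<and> A \<subseteq> arrows_into_dm G g \<and> dm G g \<in> A \<and> ginv G g \<in> A"
    and dmB: "dm ?B (A, g) = (A, dm G g)"
    and rnB: "rn ?B (A, g) = (gmult G g ` A, rn G g)"
    and mB: "gmult ?B (A, g) (A', g') = (A', g \<cdot> g')" for A g A' g'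
    by (auto simp: birget_rhodes_def)
  have into: "arrows_into_dm G (dm G g) = arrows_into_dm G g" if "g \<in> arrows G" for g
    using that by (simp add: arrows_into_dm_def i)
  have into_rn: "gmult G g ` A \<subseteq> arrows_into_dm G (rn G g)"
    if "g \<in> arrows G" "A \<subseteq> arrows_into_dm G g" for g A
    using that by (auto simp: arrows_into_dm_def i C subset_iff)
  have rn_mem: "rn G g \<in> gmult G g ` A" if "g \<in> arrows G" "ginv G g \<in> A" for g A
    using that gmult_ginv by (metis image_eqI)
  have rarr: "(gmult G g ` A, rn G g) \<in> arrows ?B" if "(A, g) \<in> arrows ?B" for A g
    using that into_rn[of g A] rn_mem[of g A] unfolding arr by (simp add: i)
  have rimg: "gmult G (rn G g) ` (gmult G g ` A) = gmult G g ` A" if "(A, g) \<in> arrows ?B" for A g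
    using image_dm[of "rn G g" "gmult G g ` A"] that into_rn[of g A] unfolding arr by (simp add: i)
  have dimg: "gmult G (dm G g) ` A = A" if "(A, g) \<in> arrows ?B" for A g
    using image_dm[of g A] that unfolding arr by simp
  have mcl: "(A', g \<cdot> g') \<in> arrows ?B" 
    if "(A, g) \<in> arrows ?B" "(A', g') \<in> arrows ?B" "A = gmult G g' ` A'" "dm G g = rn G g'" for A g A' g'
  proof -
    have c: "(g, g') \<in> composable G" using that by (auto simp: arr C)
    have "ginv G g \<in> gmult G g' ` A'" using that by (simp add: arr)
    then obtain a where a: "a \<in> A'" "ginv G g = g' \<cdot> a" by auto
    have a': "a \<in> arrows G" "rn G a = dm G g'" 
      using that(2) a(1) by (auto simp: arr arrows_into_dm_def)
    have g': "g' \<in> arrows G" "g \<in> arrows G" using that by (auto simp: arr)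
    have "ginv G (g \<cdot> g') = ginv G g' \<cdot> (g' \<cdot> a)" using ginv_mult[OF c] a by simp
    also have "\<dots> = (ginv G g' \<cdot> g') \<cdot> a"
      by (rule gmult_assoc[symmetric]) (simp_all add: C i a' g')
    also have "\<dots> = a" using left_id[of a] a' g' by (simp add: i)
    finally show ?thesis using a that c unfolding arr
      by (auto simp: i arrows_into_dm_def)
  qed
  show ?thesis
  proof (unfold_locales; (simp only: split_paired_all)?)
    fix A g assume a: "(A, g) \<in> arrows ?B"
    then have g: "g \<in> arrows G" "A \<subseteq> arrows_into_dm G g" by (auto simp: arr)
    show "dm ?B (A, g) \<in> arrows ?B" using a into unfolding dmB arr by (simp add: i)
    show "rn ?B (A, g) \<in> arrows ?B" using rarr[OF a] unfolding rnB .
    show "dm ?B (dm ?B (A, g)) = dm ?B (A, g)" using g by (simp add: dmB i)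
    show "rn ?B (dm ?B (A, g)) = dm ?B (A, g)" using g dimg[OF a] by (simp add: dmB rnB i)
    show "dm ?B (rn ?B (A, g)) = rn ?B (A, g)" using g by (simp add: dmB rnB i)
    show "rn ?B (rn ?B (A, g)) = rn ?B (A, g)" using g rimg[OF a] by (simp add: rnB i)
    show "gmult ?B (A, g) (dm ?B (A, g)) = (A, g)" using g by (simp add: dmB mB i)
    show "gmult ?B (rn ?B (A, g)) (A, g) = (A, g)" using g by (simp add: rnB mB i)
    have img: "gmult G (ginv G g) ` gmult G g ` A = A"
      using image_gmult_image[of "ginv G g" g A] g dimg[OF a] by (simp add: C i)
    have "(gmult G g ` A, ginv G g) \<in> arrows ?B"
      using rarr[OF a] a rn_mem[of g A] g right_id[of g] unfolding arr 
      by (auto simp: i ginv_ginv arrows_into_dm_def intro: rev_image_eqI)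
    then show "\<exists>h. is_ginv ?B (A, g) h"
      using g img by (intro exI[of _ "(gmult G g ` A, ginv G g)"]) 
        (simp add: is_ginv_def dmB rnB mB i)
  next
    fix A g B h assume "((A, g), (B, h)) \<in> composable ?B"
    then have a: "(A, g) \<in> arrows ?B" "(B, h) \<in> arrows ?B" "A = gmult G h ` B" "dm G g = rn G h"
      by (auto simp: composable_def dmB rnB)
    then have c: "(g, h) \<in> composable G" by (auto simp: C arr)
    show "gmult ?B (A, g) (B, h) \<in> arrows ?B" using mcl[OF a] by (simp add: mB)
    show "dm ?B (gmult ?B (A, g) (B, h)) = dm ?B (B, h)" using c by (simp add: mB dmB i)
    show "rn ?B (gmult ?B (A, g) (B, h)) = rn ?B (A, g)" 
      using c image_gmult_image[OF c, of B] a by (simp add: mB rnB i arr)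
    fix D k assume "((B, h), (D, k)) \<in> composable ?B"
    then have "(h, k) \<in> composable G" by (auto simp: composable_def dmB rnB C arr)
    then show "gmult ?B (gmult ?B (A, g) (B, h)) (D, k) = gmult ?B (A, g) (gmult ?B (B, h) (D, k))"
      using c by (simp add: mB gmult_assoc)
  qed
qed

context abelian_monoid begin

lemma finsum_swap:
  assumes "finite A" "finite B" "\<And>a b. a \<in> A \<Longrightarrow> b \<in> B \<Longrightarrow> f a b \<in> carrier G"
  shows "(\<Oplus>a\<in>A. \<Oplus>b\<in>B. f a b) = (\<Oplus>b\<in>B. \<Oplus>a\<in>A. f a b)"
  using assms(1,3)
proof (induction A rule: finite_induct)
  case empty
  then show ?case by (simp add: finsum_zero)
next
  case (insert a A)
  have "(\<Oplus>a\<in>insert a A. \<Oplus>b\<in>B. f a b) = (\<Oplus>b\<in>B. f a b) \<oplus> (\<Oplus>a\<in>A. \<Oplus>b\<in>B. f a b)"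
    by (rule finsum_insert) (use insert in \<open>auto intro!: finsum_closed\<close>)
  also have "\<dots> = (\<Oplus>b\<in>B. f a b) \<oplus> (\<Oplus>b\<in>B. \<Oplus>a\<in>A. f a b)" 
    using insert by simp
  also have "\<dots> = (\<Oplus>b\<in>B. f a b \<oplus> (\<Oplus>a\<in>A. f a b))"
    by (rule finsum_addf[symmetric]) (use insert in \<open>auto intro!: finsum_closed\<close>)
  also have "\<dots> = (\<Oplus>b\<in>B. \<Oplus>a\<in>insert a A. f a b)"
    by (rule finsum_cong') (use insert in \<open>auto intro!: finsum_closed finsum_insert[symmetric]\<close>)
  finally show ?case .
qed

lemma finsum_neutral_sub:
  assumes "finite B" "A \<subseteq> B" "\<And>b. b \<in> B - A \<Longrightarrow> f b = \<zero>" "\<And>b. b \<in> B \<Longrightarrow> f b \<in> carrier G"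
  shows "finsum G f A = finsum G f B"
  by (rule add.finprod_mono_neutral_cong_left) (use assms in auto)

lemma finsum_delta:
  assumes "finite A" "\<And>a. a \<in> A \<Longrightarrow> f a \<in> carrier G"
  shows "(\<Oplus>a\<in>A. if a = b then f a else \<zero>) = (if b \<in> A then f b else \<zero>)"
proof (cases "b \<in> A")
  case True
  then show ?thesis using add.finprod_singleton_swap[of b A f] assms by auto
next
  case False
  then have "(\<Oplus>a\<in>A. if a = b then f a else \<zero>) = (\<Oplus>a\<in>A. \<zero>)"
    by (intro finsum_cong') auto
  then show ?thesis using False by simp
qed

end

locale partial_semigroup_basis = cring K for K (structure) +
  fixes S :: "'s set" and p :: "'s \<Rightarrow> 's \<Rightarrow> 's option" and U :: "'s set"
  assumes p_closed: "\<lbrakk>y \<in> S; z \<in> S; p y z = Some x\<rbrakk> \<Longrightarrow> x \<in> S"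
    and p_assoc: "\<lbrakk>x \<in> S; y \<in> S; z \<in> S\<rbrakk> \<Longrightarrow>
      Option.bind (p x y) (\<lambda>u. p u z) = Option.bind (p y z) (\<lambda>v. p x v)"
    and U_finite: "finite U" and U_sub: "U \<subseteq> S"
    and U_left: "x \<in> S \<Longrightarrow> \<exists>u\<in>U. p u x = Some x \<and> (\<forall>v\<in>U. v \<noteq> u \<longrightarrow> p v x = None)"
    and U_right: "x \<in> S \<Longrightarrow> \<exists>u\<in>U. p x u = Some x \<and> (\<forall>v\<in>U. v \<noteq> u \<longrightarrow> p x v = None)"
begin

abbreviation "BA \<equiv> basis_algebra K S p U"

lemma BA_carrier: "f \<in> carrier BA \<longleftrightarrow> (\<forall>x. f x \<in> carrier K) \<and> finite (supp K f) \<and> supp K f \<subseteq> S"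
  by (auto simp: basis_algebra_def)

lemma BA_mult:
  assumes "f \<in> carrier BA" "g \<in> carrier BA" "finite Y" "finite Z" "supp K f \<subseteq> Y" "supp K g \<subseteq> Z"
  shows "(f \<otimes>\<^bsub>BA\<^esub> g) x = (\<Oplus>y\<in>Y. \<Oplus>z\<in>Z. if p y z = Some x then f y \<otimes> g z else \<zero>)"
proof -
  have c: "f y \<in> carrier K" "g y \<in> carrier K" for y using assms by (auto simp: BA_carrier)
  have "(f \<otimes>\<^bsub>BA\<^esub> g) x = 
     (\<Oplus>y\<in>supp K f. \<Oplus>z\<in>supp K g. if p y z = Some x then f y \<otimes> g z else \<zero>)"
    by (simp add: basis_algebra_def)
  also have "\<dots> = (\<Oplus>y\<in>supp K f. \<Oplus>z\<in>Z. if p y z = Some x then f y \<otimes> g z else \<zero>)"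
    by (intro finsum_cong' finsum_neutral_sub refl) 
       (use assms c in \<open>auto simp: supp_def intro!: finsum_closed\<close>)
  also have "\<dots> = (\<Oplus>y\<in>Y. \<Oplus>z\<in>Z. if p y z = Some x then f y \<otimes> g z else \<zero>)"
  proof (rule finsum_neutral_sub)
    fix y assume "y \<in> Y - supp K f"
    then have "f y = \<zero>" by (simp add: supp_def)
    then show "(\<Oplus>z\<in>Z. if p y z = Some x then f y \<otimes> g z else \<zero>) = \<zero>"
      using c by (intro add.finprod_one_eqI) auto
  qed (use assms c in \<open>auto intro!: finsum_closed\<close>)
  finally show ?thesis .
qed

lemma BA_mult_closed:
  assumes f: "f \<in> carrier BA" and g: "g \<in> carrier BA"
  shows "f \<otimes>\<^bsub>BA\<^esub> g \<in> carrier BA"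
    and "supp K (f \<otimes>\<^bsub>BA\<^esub> g) \<subseteq> (\<Union>y\<in>supp K f. \<Union>z\<in>supp K g. set_option (p y z))"
proof -
  have c: "f y \<in> carrier K" "g y \<in> carrier K" for y using assms by (auto simp: BA_carrier)
  have fin: "finite (supp K f)" "finite (supp K g)" "supp K f \<subseteq> S" "supp K g \<subseteq> S"
    using assms by (auto simp: BA_carrier)
  note m = BA_mult[OF f g fin(1,2) order.refl order.refl]
  show *: "supp K (f \<otimes>\<^bsub>BA\<^esub> g) \<subseteq> (\<Union>y\<in>supp K f. \<Union>z\<in>supp K g. set_option (p y z))"
  proof
    fix x assume "x \<in> supp K (f \<otimes>\<^bsub>BA\<^esub> g)"
    then have nz: "(f \<otimes>\<^bsub>BA\<^esub> g) x \<noteq> \<zero>" by (simp add: supp_def)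
    show "x \<in> (\<Union>y\<in>supp K f. \<Union>z\<in>supp K g. set_option (p y z))"
    proof (rule ccontr)
      assume n: "\<not> ?thesis"
      have "(f \<otimes>\<^bsub>BA\<^esub> g) x = \<zero>" unfolding m
        by (intro add.finprod_one_eqI) (use n in auto)
      with nz show False by simp
    qed
  qed
  have "finite (\<Union>y\<in>supp K f. \<Union>z\<in>supp K g. set_option (p y z))"
    using fin by auto
  moreover have "(\<Union>y\<in>supp K f. \<Union>z\<in>supp K g. set_option (p y z)) \<subseteq> S"
  proof (intro UN_least subsetI)
    fix y z x assume "y \<in> supp K f" "z \<in> supp K g" "x \<in> set_option (p y z)"
    then show "x \<in> S" using p_closed[of y z x] fin(3,4) by auto
  qed
  moreover have "(f \<otimes>\<^bsub>BA\<^esub> g) x \<in> carrier K" for x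
    unfolding m using c by (auto intro!: finsum_closed)
  ultimately show "f \<otimes>\<^bsub>BA\<^esub> g \<in> carrier BA" using *
    unfolding BA_carrier by (meson finite_subset order_trans)
qed

lemma BA_simps:
  "(f \<oplus>\<^bsub>BA\<^esub> g) x = f x \<oplus> g x" "\<zero>\<^bsub>BA\<^esub> x = \<zero>" "(c \<odot>\<^bsub>BA\<^esub> f) x = c \<otimes> f x"
  "\<one>\<^bsub>BA\<^esub> x = (if x \<in> U then \<one> else \<zero>)"
  by (simp_all add: basis_algebra_def)

lemma BA_abelian_group: "abelian_group BA"
proof (rule abelian_groupI)
  fix f g assume fg: "f \<in> carrier BA" "g \<in> carrier BA"
  have "supp K (f \<oplus>\<^bsub>BA\<^esub> g) \<subseteq> supp K f \<union> supp K g" by (auto simp: supp_def BA_simps)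
  with fg show "f \<oplus>\<^bsub>BA\<^esub> g \<in> carrier BA"
    unfolding BA_carrier by (auto simp: BA_simps intro: finite_subset)
next
  fix f assume f: "f \<in> carrier BA"
  have "supp K (\<lambda>x. \<ominus> f x) \<subseteq> supp K f" using f 
    by (auto simp: supp_def BA_carrier)
  then show "\<exists>g\<in>carrier BA. g \<oplus>\<^bsub>BA\<^esub> f = \<zero>\<^bsub>BA\<^esub>"
    using f by (intro bexI[of _ "\<lambda>x. \<ominus> f x"]) 
      (auto simp: BA_carrier BA_simps fun_eq_iff l_neg intro: finite_subset)
qed (auto simp: BA_carrier BA_simps fun_eq_iff supp_def a_assoc a_comm a_lcomm)

lemma BA_assoc:
  assumes f: "f \<in> carrier BA" and g: "g \<in> carrier BA" and h: "h \<in> carrier BA"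
  shows "(f \<otimes>\<^bsub>BA\<^esub> g) \<otimes>\<^bsub>BA\<^esub> h = f \<otimes>\<^bsub>BA\<^esub> (g \<otimes>\<^bsub>BA\<^esub> h)"
proof
  fix x
  let ?F = "supp K f" and ?G = "supp K g" and ?H = "supp K h"
  have c [simp]: "f y \<in> carrier K" "g y \<in> carrier K" "h y \<in> carrier K" for y 
    using assms by (auto simp: BA_carrier)
  have fin [simp]: "finite ?F" "finite ?G" "finite ?H" and sub: "?F \<subseteq> S" "?G \<subseteq> S" "?H \<subseteq> S"
    using assms by (auto simp: BA_carrier)
  define V where "V = (\<Union>y\<in>?F. \<Union>z\<in>?G. set_option (p y z))"
  define W where "W = (\<Union>y\<in>?G. \<Union>z\<in>?H. set_option (p y z))"
  have [simp]: "finite V" "finite W" by (auto simp: V_def W_def)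
  have "((f \<otimes>\<^bsub>BA\<^esub> g) \<otimes>\<^bsub>BA\<^esub> h) x =
      (\<Oplus>u\<in>V. \<Oplus>c\<in>?H. if p u c = Some x then (f \<otimes>\<^bsub>BA\<^esub> g) u \<otimes> h c else \<zero>)"
    by (rule BA_mult) (use assms BA_mult_closed[OF f g] in \<open>auto simp: V_def\<close>)
  also have "\<dots> = (\<Oplus>u\<in>V. \<Oplus>c\<in>?H. \<Oplus>a\<in>?F. \<Oplus>b\<in>?G. 
      if p a b = Some u \<and> p u c = Some x then f a \<otimes> g b \<otimes> h c else \<zero>)"
  proof -
    have "(if p u c = Some x then (f \<otimes>\<^bsub>BA\<^esub> g) u \<otimes> h c else \<zero>) =
      (\<Oplus>a\<in>?F. \<Oplus>b\<in>?G. if p a b = Some u \<and> p u c = Some x then f a \<otimes> g b \<otimes> h c else \<zero>)" for u c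
    proof (cases "p u c = Some x")
      case True
      have "(f \<otimes>\<^bsub>BA\<^esub> g) u = (\<Oplus>a\<in>?F. \<Oplus>b\<in>?G. if p a b = Some u then f a \<otimes> g b else \<zero>)"
        by (rule BA_mult) (use assms in auto)
      then have "(f \<otimes>\<^bsub>BA\<^esub> g) u \<otimes> h c = 
          (\<Oplus>a\<in>?F. \<Oplus>b\<in>?G. (if p a b = Some u then f a \<otimes> g b else \<zero>) \<otimes> h c)"
        by (simp add: finsum_ldistr Pi_def cong: finsum_cong)
      also have "\<dots> = (\<Oplus>a\<in>?F. \<Oplus>b\<in>?G. (if p a b = Some u then f a \<otimes> g b \<otimes> h c else \<zero>))"
        by (intro finsum_cong') auto
      finally show ?thesis using True by simp
    next
      case False
      then show ?thesis by (simp add: add.finprod_one_eqI)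
    qed
    then show ?thesis by simp
  qed
  also have "\<dots> = (\<Oplus>u\<in>V. \<Oplus>a\<in>?F. \<Oplus>b\<in>?G. \<Oplus>c\<in>?H.
      if p a b = Some u \<and> p u c = Some x then f a \<otimes> g b \<otimes> h c else \<zero>)"
  proof (rule finsum_cong'[OF refl])
    fix u
    have "(\<Oplus>c\<in>?H. \<Oplus>a\<in>?F. \<Oplus>b\<in>?G. 
        if p a b = Some u \<and> p u c = Some x then f a \<otimes> g b \<otimes> h c else \<zero>) =
      (\<Oplus>a\<in>?F. \<Oplus>c\<in>?H. \<Oplus>b\<in>?G. 
        if p a b = Some u \<and> p u c = Some x then f a \<otimes> g b \<otimes> h c else \<zero>)"
      by (rule finsum_swap) (auto intro!: finsum_closed)
    also have "\<dots> = (\<Oplus>a\<in>?F. \<Oplus>b\<in>?G. \<Oplus>c\<in>?H. 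
        if p a b = Some u \<and> p u c = Some x then f a \<otimes> g b \<otimes> h c else \<zero>)"
      by (intro finsum_cong' finsum_swap refl) (auto intro!: finsum_closed)
    finally show "(\<Oplus>c\<in>?H. \<Oplus>a\<in>?F. \<Oplus>b\<in>?G. 
        if p a b = Some u \<and> p u c = Some x then f a \<otimes> g b \<otimes> h c else \<zero>) = \<dots>" .
  qed (auto intro!: finsum_closed)
  also have "\<dots> = (\<Oplus>a\<in>?F. \<Oplus>u\<in>V. \<Oplus>b\<in>?G. \<Oplus>c\<in>?H.
      if p a b = Some u \<and> p u c = Some x then f a \<otimes> g b \<otimes> h c else \<zero>)"
    by (rule finsum_swap) (auto intro!: finsum_closed)
  also have "\<dots> = (\<Oplus>a\<in>?F. \<Oplus>b\<in>?G. \<Oplus>u\<in>V. \<Oplus>c\<in>?H.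
      if p a b = Some u \<and> p u c = Some x then f a \<otimes> g b \<otimes> h c else \<zero>)"
    by (intro finsum_cong' finsum_swap refl) (auto intro!: finsum_closed)
  also have "\<dots> = (\<Oplus>a\<in>?F. \<Oplus>b\<in>?G. \<Oplus>c\<in>?H. \<Oplus>u\<in>V.
      if p a b = Some u \<and> p u c = Some x then f a \<otimes> g b \<otimes> h c else \<zero>)"
    by (intro finsum_cong' finsum_swap refl) (auto intro!: finsum_closed)
  also have "\<dots> = (\<Oplus>a\<in>?F. \<Oplus>b\<in>?G. \<Oplus>c\<in>?H.
      if Option.bind (p a b) (\<lambda>u. p u c) = Some x then f a \<otimes> g b \<otimes> h c else \<zero>)"
  proof (intro finsum_cong'[OF refl])
    fix a b c' assume *: "a \<in> ?F" "b \<in> ?G" "c' \<in> ?H"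
    show "(\<Oplus>u\<in>V. if p a b = Some u \<and> p u c' = Some x then f a \<otimes> g b \<otimes> h c' else \<zero>) =
      (if Option.bind (p a b) (\<lambda>u. p u c') = Some x then f a \<otimes> g b \<otimes> h c' else \<zero>)"
    proof (cases "p a b")
      case None
      then show ?thesis by simp
    next
      case (Some w)
      have "(\<Oplus>u\<in>V. if p a b = Some u \<and> p u c' = Some x then f a \<otimes> g b \<otimes> h c' else \<zero>) =
        (\<Oplus>u\<in>V. if u = w then (if p w c' = Some x then f a \<otimes> g b \<otimes> h c' else \<zero>) else \<zero>)"
        by (intro finsum_cong') (use Some in auto)
      also have "\<dots> = (if w \<in> V then (if p w c' = Some x then f a \<otimes> g b \<otimes> h c' else \<zero>) else \<zero>)"
        by (rule finsum_delta) auto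
      also have "\<dots> = (if p w c' = Some x then f a \<otimes> g b \<otimes> h c' else \<zero>)"
        using Some * by (force simp: V_def)
      finally show ?thesis using Some by simp
    qed
  qed (auto intro!: finsum_closed)
  also have "\<dots> = (\<Oplus>a\<in>?F. \<Oplus>b\<in>?G. \<Oplus>c\<in>?H.
      if Option.bind (p b c) (\<lambda>v. p a v) = Some x then f a \<otimes> g b \<otimes> h c else \<zero>)"
    by (intro finsum_cong'[OF refl]) (use sub p_assoc in \<open>auto intro!: finsum_closed simp: subset_iff\<close>)
  also have "\<dots> = (\<Oplus>a\<in>?F. \<Oplus>b\<in>?G. \<Oplus>c\<in>?H. \<Oplus>v\<in>W.
      if p b c = Some v \<and> p a v = Some x then f a \<otimes> g b \<otimes> h c else \<zero>)"
  proof (intro finsum_cong'[OF refl])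
    fix a b c' assume *: "a \<in> ?F" "b \<in> ?G" "c' \<in> ?H"
    show "(if Option.bind (p b c') (\<lambda>v. p a v) = Some x then f a \<otimes> g b \<otimes> h c' else \<zero>) = 
      (\<Oplus>v\<in>W. if p b c' = Some v \<and> p a v = Some x then f a \<otimes> g b \<otimes> h c' else \<zero>)"
    proof (cases "p b c'")
      case None
      then show ?thesis by simp
    next
      case (Some w)
      have "(\<Oplus>v\<in>W. if p b c' = Some v \<and> p a v = Some x then f a \<otimes> g b \<otimes> h c' else \<zero>) =
        (\<Oplus>v\<in>W. if v = w then (if p a w = Some x then f a \<otimes> g b \<otimes> h c' else \<zero>) else \<zero>)"
        by (intro finsum_cong') (use Some in auto)
      also have "\<dots> = (if w \<in> W then (if p a w = Some x then f a \<otimes> g b \<otimes> h c' else \<zero>) else \<zero>)"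
        by (rule finsum_delta) auto
      also have "\<dots> = (if p a w = Some x then f a \<otimes> g b \<otimes> h c' else \<zero>)"
        using Some * by (force simp: W_def)
      finally show ?thesis using Some by simp
    qed
  qed (auto intro!: finsum_closed)
  also have "\<dots> = (\<Oplus>a\<in>?F. \<Oplus>b\<in>?G. \<Oplus>v\<in>W. \<Oplus>c\<in>?H.
      if p b c = Some v \<and> p a v = Some x then f a \<otimes> g b \<otimes> h c else \<zero>)"
    by (intro finsum_cong' finsum_swap refl) (auto intro!: finsum_closed)
  also have "\<dots> = (\<Oplus>a\<in>?F. \<Oplus>v\<in>W. \<Oplus>b\<in>?G. \<Oplus>c\<in>?H.
      if p b c = Some v \<and> p a v = Some x then f a \<otimes> g b \<otimes> h c else \<zero>)"
    by (intro finsum_cong' finsum_swap refl) (auto intro!: finsum_closed)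
  also have "\<dots> = (\<Oplus>a\<in>?F. \<Oplus>v\<in>W. if p a v = Some x then f a \<otimes> (g \<otimes>\<^bsub>BA\<^esub> h) v else \<zero>)"
  proof -
    have "(if p a v = Some x then f a \<otimes> (g \<otimes>\<^bsub>BA\<^esub> h) v else \<zero>) =
      (\<Oplus>b\<in>?G. \<Oplus>c\<in>?H. if p b c = Some v \<and> p a v = Some x then f a \<otimes> g b \<otimes> h c else \<zero>)" for a v
    proof (cases "p a v = Some x")
      case True
      have "(g \<otimes>\<^bsub>BA\<^esub> h) v = (\<Oplus>b\<in>?G. \<Oplus>c\<in>?H. if p b c = Some v then g b \<otimes> h c else \<zero>)"
        by (rule BA_mult) (use assms in auto)
      then have "f a \<otimes> (g \<otimes>\<^bsub>BA\<^esub> h) v = 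
          (\<Oplus>b\<in>?G. \<Oplus>c\<in>?H. f a \<otimes> (if p b c = Some v then g b \<otimes> h c else \<zero>))"
        by (simp add: finsum_rdistr Pi_def cong: finsum_cong)
      also have "\<dots> = (\<Oplus>b\<in>?G. \<Oplus>c\<in>?H. (if p b c = Some v then f a \<otimes> g b \<otimes> h c else \<zero>))"
        by (intro finsum_cong') (auto simp: m_assoc)
      finally show ?thesis using True by simp
    next
      case False
      then show ?thesis by (simp add: add.finprod_one_eqI)
    qed
    then show ?thesis by simp
  qed
  also have "\<dots> = (f \<otimes>\<^bsub>BA\<^esub> (g \<otimes>\<^bsub>BA\<^esub> h)) x"
    by (rule BA_mult[symmetric]) (use assms BA_mult_closed[OF g h] in \<open>auto simp: W_def\<close>)
  finally show "((f \<otimes>\<^bsub>BA\<^esub> g) \<otimes>\<^bsub>BA\<^esub> h) x = (f \<otimes>\<^bsub>BA\<^esub> (g \<otimes>\<^bsub>BA\<^esub> h)) x" .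
qed

lemma BA_one_closed: "\<one>\<^bsub>BA\<^esub> \<in> carrier BA"
proof -
  have "supp K \<one>\<^bsub>BA\<^esub> \<subseteq> U" by (auto simp: supp_def BA_simps)
  then show ?thesis using U_finite U_sub 
    unfolding BA_carrier by (auto simp: BA_simps intro: finite_subset)
qed

lemma BA_one:
  assumes f: "f \<in> carrier BA"
  shows "\<one>\<^bsub>BA\<^esub> \<otimes>\<^bsub>BA\<^esub> f = f" "f \<otimes>\<^bsub>BA\<^esub> \<one>\<^bsub>BA\<^esub> = f"
proof -
  have s: "supp K \<one>\<^bsub>BA\<^esub> \<subseteq> U" by (auto simp: supp_def BA_simps)
  have c [simp]: "f y \<in> carrier K" for y using f by (auto simp: BA_carrier)
  have fin [simp]: "finite (supp K f)" "finite U" using f U_finite by (auto simp: BA_carrier)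
  have out: "x \<notin> supp K f \<Longrightarrow> f x = \<zero>" for x by (simp add: supp_def)
  have sub: "supp K f \<subseteq> S" using f by (auto simp: BA_carrier)
  show "\<one>\<^bsub>BA\<^esub> \<otimes>\<^bsub>BA\<^esub> f = f"
  proof
    fix x
    have "(\<one>\<^bsub>BA\<^esub> \<otimes>\<^bsub>BA\<^esub> f) x = 
        (\<Oplus>u\<in>U. \<Oplus>z\<in>supp K f. if p u z = Some x then \<one>\<^bsub>BA\<^esub> u \<otimes> f z else \<zero>)"
      by (rule BA_mult) (use f s BA_one_closed in auto)
    also have "\<dots> = (\<Oplus>z\<in>supp K f. \<Oplus>u\<in>U. if p u z = Some x then \<one>\<^bsub>BA\<^esub> u \<otimes> f z else \<zero>)"
      by (rule finsum_swap) (auto simp: BA_simps)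
    also have "\<dots> = (\<Oplus>z\<in>supp K f. if z = x then f z else \<zero>)"
    proof (rule finsum_cong'[OF refl])
      fix z assume "z \<in> supp K f"
      then obtain u where u: "u \<in> U" "p u z = Some z" "\<forall>v\<in>U. v \<noteq> u \<longrightarrow> p v z = None"
        using U_left sub by blast
      have "(\<Oplus>u\<in>U. if p u z = Some x then \<one>\<^bsub>BA\<^esub> u \<otimes> f z else \<zero>) =
        (\<Oplus>v\<in>U. if v = u then (if z = x then f z else \<zero>) else \<zero>)"
        by (intro finsum_cong') (use u in \<open>auto simp: BA_simps\<close>)
      also have "\<dots> = (if z = x then f z else \<zero>)"
        using finsum_delta[of U "\<lambda>_. if z = x then f z else \<zero>" u] u by auto
      finally show "(\<Oplus>u\<in>U. if p u z = Some x then \<one>\<^bsub>BA\<^esub> u \<otimes> f z else \<zero>) = \<dots>" .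
    qed auto
    also have "\<dots> = f x" using finsum_delta[of "supp K f" f x] out by auto
    finally show "(\<one>\<^bsub>BA\<^esub> \<otimes>\<^bsub>BA\<^esub> f) x = f x" .
  qed
  show "f \<otimes>\<^bsub>BA\<^esub> \<one>\<^bsub>BA\<^esub> = f"
  proof
    fix x
    have "(f \<otimes>\<^bsub>BA\<^esub> \<one>\<^bsub>BA\<^esub>) x = 
        (\<Oplus>z\<in>supp K f. \<Oplus>u\<in>U. if p z u = Some x then f z \<otimes> \<one>\<^bsub>BA\<^esub> u else \<zero>)"
      by (rule BA_mult) (use f s BA_one_closed in auto)
    also have "\<dots> = (\<Oplus>z\<in>supp K f. if z = x then f z else \<zero>)"
    proof (rule finsum_cong'[OF refl])
      fix z assume "z \<in> supp K f"
      then obtain u where u: "u \<in> U" "p z u = Some z" "\<forall>v\<in>U. v \<noteq> u \<longrightarrow> p z v = None"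
        using U_right sub by blast
      have "(\<Oplus>u\<in>U. if p z u = Some x then f z \<otimes> \<one>\<^bsub>BA\<^esub> u else \<zero>) =
        (\<Oplus>v\<in>U. if v = u then (if z = x then f z else \<zero>) else \<zero>)"
        by (intro finsum_cong') (use u in \<open>auto simp: BA_simps\<close>)
      also have "\<dots> = (if z = x then f z else \<zero>)"
        using finsum_delta[of U "\<lambda>_. if z = x then f z else \<zero>" u] u by auto
      finally show "(\<Oplus>u\<in>U. if p z u = Some x then f z \<otimes> \<one>\<^bsub>BA\<^esub> u else \<zero>) = \<dots>" .
    qed auto
    also have "\<dots> = f x" using finsum_delta[of "supp K f" f x] out by auto
    finally show "(f \<otimes>\<^bsub>BA\<^esub> \<one>\<^bsub>BA\<^esub>) x = f x" .
  qed
qed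

lemma BA_distr:
  assumes f: "f \<in> carrier BA" and g: "g \<in> carrier BA" and h: "h \<in> carrier BA"
  shows "(f \<oplus>\<^bsub>BA\<^esub> g) \<otimes>\<^bsub>BA\<^esub> h = f \<otimes>\<^bsub>BA\<^esub> h \<oplus>\<^bsub>BA\<^esub> g \<otimes>\<^bsub>BA\<^esub> h"
    "h \<otimes>\<^bsub>BA\<^esub> (f \<oplus>\<^bsub>BA\<^esub> g) = h \<otimes>\<^bsub>BA\<^esub> f \<oplus>\<^bsub>BA\<^esub> h \<otimes>\<^bsub>BA\<^esub> g"
proof -
  interpret A: abelian_group BA by (rule BA_abelian_group)
  let ?Y = "supp K f \<union> supp K g" and ?Z = "supp K h"
  have c [simp]: "f y \<in> carrier K" "g y \<in> carrier K" "h y \<in> carrier K" for y 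
    using assms by (auto simp: BA_carrier)
  have fin [simp]: "finite (supp K f)" "finite (supp K g)" "finite ?Z"
    using assms by (auto simp: BA_carrier)
  have s: "supp K (f \<oplus>\<^bsub>BA\<^esub> g) \<subseteq> ?Y" by (auto simp: supp_def BA_simps)
  have fg: "f \<oplus>\<^bsub>BA\<^esub> g \<in> carrier BA" using f g by simp
  note m = BA_mult[where Y = ?Y and Z = ?Z] BA_mult[where Y = ?Z and Z = ?Y]
  show "(f \<oplus>\<^bsub>BA\<^esub> g) \<otimes>\<^bsub>BA\<^esub> h = f \<otimes>\<^bsub>BA\<^esub> h \<oplus>\<^bsub>BA\<^esub> g \<otimes>\<^bsub>BA\<^esub> h"
  proof
    fix x
    have "((f \<oplus>\<^bsub>BA\<^esub> g) \<otimes>\<^bsub>BA\<^esub> h) x =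
      (\<Oplus>y\<in>?Y. \<Oplus>z\<in>?Z. if p y z = Some x then (f \<oplus>\<^bsub>BA\<^esub> g) y \<otimes> h z else \<zero>)"
      by (rule m) (use s fg h in auto)
    also have "\<dots> = (\<Oplus>y\<in>?Y. \<Oplus>z\<in>?Z. (if p y z = Some x then f y \<otimes> h z else \<zero>) \<oplus>
        (if p y z = Some x then g y \<otimes> h z else \<zero>))"
      by (intro finsum_cong') (auto simp: BA_simps l_distr intro!: finsum_closed)
    also have "\<dots> = (\<Oplus>y\<in>?Y. \<Oplus>z\<in>?Z. if p y z = Some x then f y \<otimes> h z else \<zero>) \<oplus>
        (\<Oplus>y\<in>?Y. \<Oplus>z\<in>?Z. if p y z = Some x then g y \<otimes> h z else \<zero>)"
      by (simp add: finsum_addf Pi_def)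
    also have "\<dots> = (f \<otimes>\<^bsub>BA\<^esub> h \<oplus>\<^bsub>BA\<^esub> g \<otimes>\<^bsub>BA\<^esub> h) x"
      unfolding BA_simps using m(1)[OF f h, of x] m(1)[OF g h, of x] by simp
    finally show "((f \<oplus>\<^bsub>BA\<^esub> g) \<otimes>\<^bsub>BA\<^esub> h) x = \<dots>" .
  qed
  show "h \<otimes>\<^bsub>BA\<^esub> (f \<oplus>\<^bsub>BA\<^esub> g) = h \<otimes>\<^bsub>BA\<^esub> f \<oplus>\<^bsub>BA\<^esub> h \<otimes>\<^bsub>BA\<^esub> g"
  proof
    fix x
    have "(h \<otimes>\<^bsub>BA\<^esub> (f \<oplus>\<^bsub>BA\<^esub> g)) x =
      (\<Oplus>z\<in>?Z. \<Oplus>y\<in>?Y. if p z y = Some x then h z \<otimes> (f \<oplus>\<^bsub>BA\<^esub> g) y else \<zero>)"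
      by (rule m) (use s fg h in auto)
    also have "\<dots> = (\<Oplus>z\<in>?Z. \<Oplus>y\<in>?Y. (if p z y = Some x then h z \<otimes> f y else \<zero>) \<oplus>
        (if p z y = Some x then h z \<otimes> g y else \<zero>))"
      by (intro finsum_cong') (auto simp: BA_simps r_distr intro!: finsum_closed)
    also have "\<dots> = (\<Oplus>z\<in>?Z. \<Oplus>y\<in>?Y. if p z y = Some x then h z \<otimes> f y else \<zero>) \<oplus>
        (\<Oplus>z\<in>?Z. \<Oplus>y\<in>?Y. if p z y = Some x then h z \<otimes> g y else \<zero>)"
      by (simp add: finsum_addf Pi_def)
    also have "\<dots> = (h \<otimes>\<^bsub>BA\<^esub> f \<oplus>\<^bsub>BA\<^esub> h \<otimes>\<^bsub>BA\<^esub> g) x"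
      unfolding BA_simps using m(2)[OF h f, of x] m(2)[OF h g, of x] by simp
    finally show "(h \<otimes>\<^bsub>BA\<^esub> (f \<oplus>\<^bsub>BA\<^esub> g)) x = \<dots>" .
  qed
qed

lemma BA_smult_closed:
  assumes "c \<in> carrier K" "f \<in> carrier BA"
  shows "c \<odot>\<^bsub>BA\<^esub> f \<in> carrier BA"
proof -
  have "supp K (c \<odot>\<^bsub>BA\<^esub> f) \<subseteq> supp K f" using assms by (auto simp: supp_def BA_simps)
  then show ?thesis using assms unfolding BA_carrier by (auto simp: BA_simps intro: finite_subset)
qed

lemma BA_smult_mult:
  assumes a: "a \<in> carrier K" and f: "f \<in> carrier BA" and g: "g \<in> carrier BA"
  shows "(a \<odot>\<^bsub>BA\<^esub> f) \<otimes>\<^bsub>BA\<^esub> g = a \<odot>\<^bsub>BA\<^esub> (f \<otimes>\<^bsub>BA\<^esub> g)"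
    "f \<otimes>\<^bsub>BA\<^esub> (a \<odot>\<^bsub>BA\<^esub> g) = a \<odot>\<^bsub>BA\<^esub> (f \<otimes>\<^bsub>BA\<^esub> g)"
proof -
  let ?Y = "supp K f" and ?Z = "supp K g"
  have c [simp]: "f y \<in> carrier K" "g y \<in> carrier K" for y 
    using assms by (auto simp: BA_carrier)
  have fin [simp]: "finite ?Y" "finite ?Z" using assms by (auto simp: BA_carrier)
  have s: "supp K (a \<odot>\<^bsub>BA\<^esub> f) \<subseteq> ?Y" "supp K (a \<odot>\<^bsub>BA\<^esub> g) \<subseteq> ?Z"
    using a by (auto simp: supp_def BA_simps)
  have m: "(a \<odot>\<^bsub>BA\<^esub> (f \<otimes>\<^bsub>BA\<^esub> g)) x =
      (\<Oplus>y\<in>?Y. \<Oplus>z\<in>?Z. if p y z = Some x then a \<otimes> (f y \<otimes> g z) else \<zero>)" for x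
  proof -
    have "(a \<odot>\<^bsub>BA\<^esub> (f \<otimes>\<^bsub>BA\<^esub> g)) x = 
       a \<otimes> (\<Oplus>y\<in>?Y. \<Oplus>z\<in>?Z. if p y z = Some x then f y \<otimes> g z else \<zero>)"
      unfolding BA_simps using BA_mult[OF f g, of ?Y ?Z x] by simp
    also have "\<dots> = (\<Oplus>y\<in>?Y. \<Oplus>z\<in>?Z. a \<otimes> (if p y z = Some x then f y \<otimes> g z else \<zero>))"
      using a by (simp add: finsum_rdistr Pi_def cong: finsum_cong)
    also have "\<dots> = (\<Oplus>y\<in>?Y. \<Oplus>z\<in>?Z. if p y z = Some x then a \<otimes> (f y \<otimes> g z) else \<zero>)"
      by (intro finsum_cong') (use a in auto)
    finally show ?thesis .
  qed
  show "(a \<odot>\<^bsub>BA\<^esub> f) \<otimes>\<^bsub>BA\<^esub> g = a \<odot>\<^bsub>BA\<^esub> (f \<otimes>\<^bsub>BA\<^esub> g)"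
  proof
    fix x
    have "((a \<odot>\<^bsub>BA\<^esub> f) \<otimes>\<^bsub>BA\<^esub> g) x = 
      (\<Oplus>y\<in>?Y. \<Oplus>z\<in>?Z. if p y z = Some x then (a \<odot>\<^bsub>BA\<^esub> f) y \<otimes> g z else \<zero>)"
      by (rule BA_mult) (use s g BA_smult_closed[OF a f] in auto)
    also have "\<dots> = (\<Oplus>y\<in>?Y. \<Oplus>z\<in>?Z. if p y z = Some x then a \<otimes> (f y \<otimes> g z) else \<zero>)"
      by (intro finsum_cong') (use a in \<open>auto simp: BA_simps m_assoc\<close>)
    finally show "((a \<odot>\<^bsub>BA\<^esub> f) \<otimes>\<^bsub>BA\<^esub> g) x = (a \<odot>\<^bsub>BA\<^esub> (f \<otimes>\<^bsub>BA\<^esub> g)) x" using m by simp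
  qed
  show "f \<otimes>\<^bsub>BA\<^esub> (a \<odot>\<^bsub>BA\<^esub> g) = a \<odot>\<^bsub>BA\<^esub> (f \<otimes>\<^bsub>BA\<^esub> g)"
  proof
    fix x
    have "(f \<otimes>\<^bsub>BA\<^esub> (a \<odot>\<^bsub>BA\<^esub> g)) x = 
      (\<Oplus>y\<in>?Y. \<Oplus>z\<in>?Z. if p y z = Some x then f y \<otimes> (a \<odot>\<^bsub>BA\<^esub> g) z else \<zero>)"
      by (rule BA_mult) (use s f BA_smult_closed[OF a g] in auto)
    also have "\<dots> = (\<Oplus>y\<in>?Y. \<Oplus>z\<in>?Z. if p y z = Some x then a \<otimes> (f y \<otimes> g z) else \<zero>)"
      by (intro finsum_cong') (use a in \<open>auto simp: BA_simps m_lcomm\<close>)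
    finally show "(f \<otimes>\<^bsub>BA\<^esub> (a \<odot>\<^bsub>BA\<^esub> g)) x = (a \<odot>\<^bsub>BA\<^esub> (f \<otimes>\<^bsub>BA\<^esub> g)) x" using m by simp
  qed
qed

theorem assoc_algebra_BA: "assoc_algebra K BA"
proof -
  interpret A: ring BA
    by (intro ringI BA_abelian_group monoidI BA_distr) 
       (simp_all add: BA_mult_closed BA_one_closed BA_assoc BA_one)
  interpret module K BA
  proof (rule moduleI)
    show "cring K" by (rule is_cring)
    show "abelian_group BA" by (rule BA_abelian_group)
    show "c \<odot>\<^bsub>BA\<^esub> f \<in> carrier BA" if "c \<in> carrier K" "f \<in> carrier BA" for c f
      using that by (rule BA_smult_closed)
  qed (auto simp: BA_carrier BA_simps l_distr r_distr m_assoc intro!: ext)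
  show ?thesis by unfold_locales (simp_all add: BA_smult_mult)
qed

end

lemma assoc_algebra_groupoid_algebra:
  assumes "field K" "groupoid G" "finite (arrows G)"
  shows "assoc_algebra K (groupoid_algebra K G)"
proof -
  interpret field K by fact
  interpret G: groupoid G by fact
  note i = G.dm_gmult G.rn_gmult G.gmult_closed composable_def G.gmult_assoc
  interpret partial_semigroup_basis K "arrows G" 
    "\<lambda>g h. if dm G g = rn G h then Some (gmult G g h) else None" "objects G"
  proof unfold_locales
    have o: "dm G v = v" "rn G v = v" "v \<in> arrows G" if "v \<in> objects G" for v
      using that G.rn_dm[of v] by (auto simp: objects_def)
    fix x assume x: "x \<in> arrows G"
    have "rn G x \<in> objects G" "dm G x \<in> objects G"
      using x by (auto simp: objects_def G.dm_closed G.rn_closed G.dm_dm G.dm_rn)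
    then show "\<exists>u\<in>objects G. (if dm G u = rn G x then Some (gmult G u x) else None) = Some x \<and>
            (\<forall>v\<in>objects G. v \<noteq> u \<longrightarrow> (if dm G v = rn G x then Some (gmult G v x) else None) = None)"
      and "\<exists>u\<in>objects G. (if dm G x = rn G u then Some (gmult G x u) else None) = Some x \<and>
            (\<forall>v\<in>objects G. v \<noteq> u \<longrightarrow> (if dm G x = rn G v then Some (gmult G x v) else None) = None)"
      using x G.left_id[of x] G.right_id[of x] o by (metis option.inject)+
  qed (use assms(3) in \<open>auto simp: i objects_def split: if_splits\<close>)
  show ?thesis unfolding groupoid_algebra_def by (rule assoc_algebra_BA)
qed

lemma assoc_algebra_free_algebra:
  assumes "field K"
  shows "assoc_algebra K (free_algebra K X)"
proof -
  interpret field K by fact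
  interpret partial_semigroup_basis K "lists X" "\<lambda>v w. Some (v @ w)" "{[]}"
    by unfold_locales auto
  show ?thesis unfolding free_algebra_def by (rule assoc_algebra_BA)
qed

lemma assoc_algebra_quot_algebra:
  assumes "assoc_algebra K A" "ideal I A"
  shows "assoc_algebra K (quot_algebra A I)"
proof -
  interpret assoc_algebra K A by fact
  interpret I: ideal I A by fact
  let ?Q = "quot_algebra A I"
  have coset: "X \<in> carrier ?Q \<longleftrightarrow> (\<exists>x\<in>carrier A. X = I +>\<^bsub>A\<^esub> x)" for X
    by (auto simp: quot_algebra_def FactRing_simps)
  have sI: "c \<odot>\<^bsub>A\<^esub> i \<in> I" if "c \<in> carrier K" "i \<in> I" for c i
  proof -
    have "c \<odot>\<^bsub>A\<^esub> i = (c \<odot>\<^bsub>A\<^esub> \<one>\<^bsub>A\<^esub>) \<otimes>\<^bsub>A\<^esub> i"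
      using that I.a_subset smult_mult_left[of c "\<one>\<^bsub>A\<^esub>" i] by auto
    then show ?thesis using that I.I_l_closed by simp
  qed
  have sm: "c \<odot>\<^bsub>?Q\<^esub> (I +>\<^bsub>A\<^esub> x) = I +>\<^bsub>A\<^esub> (c \<odot>\<^bsub>A\<^esub> x)" if "c \<in> carrier K" "x \<in> carrier A" for c x
  proof -
    have "I +>\<^bsub>A\<^esub> (c \<odot>\<^bsub>A\<^esub> y) = I +>\<^bsub>A\<^esub> (c \<odot>\<^bsub>A\<^esub> x)" if "y \<in> I +>\<^bsub>A\<^esub> x" for y
    proof -
      obtain i where i: "i \<in> I" "y = i \<oplus>\<^bsub>A\<^esub> x" using \<open>y \<in> I +>\<^bsub>A\<^esub> x\<close> by (auto simp: a_r_coset_def')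
      have ic: "i \<in> carrier A" using i I.a_subset by auto
      have "c \<odot>\<^bsub>A\<^esub> y = c \<odot>\<^bsub>A\<^esub> i \<oplus>\<^bsub>A\<^esub> c \<odot>\<^bsub>A\<^esub> x"
        using i ic \<open>c \<in> carrier K\<close> \<open>x \<in> carrier A\<close> by (simp add: smult_r_distr)
      then have "c \<odot>\<^bsub>A\<^esub> y \<in> I +>\<^bsub>A\<^esub> (c \<odot>\<^bsub>A\<^esub> x)"
        using sI[OF \<open>c \<in> carrier K\<close> i(1)] by (auto simp: a_r_coset_def')
      then show ?thesis 
        using I.a_repr_independence'[of "c \<odot>\<^bsub>A\<^esub> y" "c \<odot>\<^bsub>A\<^esub> x"] \<open>c \<in> carrier K\<close> \<open>x \<in> carrier A\<close>
        by simp
    qed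
    moreover have "x \<in> I +>\<^bsub>A\<^esub> x" using that I.a_rcos_self by simp
    ultimately have "(\<Union>a\<in>I +>\<^bsub>A\<^esub> x. I +>\<^bsub>A\<^esub> (c \<odot>\<^bsub>A\<^esub> a)) = I +>\<^bsub>A\<^esub> (c \<odot>\<^bsub>A\<^esub> x)"
      by blast
    then show ?thesis by (simp add: quot_algebra_def)
  qed
  have eqs: "x \<oplus>\<^bsub>?Q\<^esub> y = x \<oplus>\<^bsub>A Quot I\<^esub> y" "x \<otimes>\<^bsub>?Q\<^esub> y = x \<otimes>\<^bsub>A Quot I\<^esub> y"
    "\<one>\<^bsub>?Q\<^esub> = \<one>\<^bsub>A Quot I\<^esub>" "\<zero>\<^bsub>?Q\<^esub> = \<zero>\<^bsub>A Quot I\<^esub>" "carrier ?Q = carrier (A Quot I)" for x y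
    by (simp_all add: quot_algebra_def)
  have add: "(I +>\<^bsub>A\<^esub> x) \<oplus>\<^bsub>?Q\<^esub> (I +>\<^bsub>A\<^esub> y) = I +>\<^bsub>A\<^esub> (x \<oplus>\<^bsub>A\<^esub> y)"
    and mult: "(I +>\<^bsub>A\<^esub> x) \<otimes>\<^bsub>?Q\<^esub> (I +>\<^bsub>A\<^esub> y) = I +>\<^bsub>A\<^esub> (x \<otimes>\<^bsub>A\<^esub> y)" 
    if "x \<in> carrier A" "y \<in> carrier A" for x y
    using that by (simp_all add: eqs FactRing_def I.a_rcos_sum I.rcoset_mult_add)
  interpret QR: ring "A Quot I" by (rule I.quotient_is_ring)
  have inv: "\<exists>y\<in>carrier (A Quot I). y \<oplus>\<^bsub>A Quot I\<^esub> x = \<zero>\<^bsub>A Quot I\<^esub>"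
    if "x \<in> carrier (A Quot I)" for x
    using that QR.l_neg QR.a_inv_closed by blast
  interpret Q: ring ?Q
    by (intro ringI abelian_groupI monoidI; unfold eqs)
       (auto simp: QR.a_assoc QR.m_assoc QR.l_distr QR.r_distr QR.a_comm QR.a_lcomm inv)
  interpret module K ?Q
    by (rule moduleI[OF is_cring Q.abelian_group_axioms])
       (auto simp: coset sm add smult_l_distr smult_r_distr smult_assoc1 intro: M.add.m_closed smult_closed)
  show ?thesis
    by unfold_locales (auto simp: coset sm mult smult_mult_left smult_mult_right)
qed

lemma basis_vector_closed:
  assumes "field K" "g \<in> X"
  shows "basis_vector K [g] \<in> carrier (free_algebra K X)"
proof -
  interpret field K by fact
  have "supp K (basis_vector K [g]) \<subseteq> {[g]}" by (auto simp: supp_def basis_vector_def)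
  then have "finite (supp K (basis_vector K [g]))" "supp K (basis_vector K [g]) \<subseteq> lists X"
    using assms(2) by (auto intro: finite_subset)
  then show ?thesis by (auto simp: free_algebra_def basis_algebra_def basis_vector_def)
qed

lemma par_relators_subset:
  assumes "field K" "groupoid G"
  shows "par_relators K G \<subseteq> carrier (free_algebra K (arrows G))"
proof -
  interpret G: groupoid G by fact
  interpret F: assoc_algebra K "free_algebra K (arrows G)"
    by (rule assoc_algebra_free_algebra) fact
  note b = basis_vector_closed[OF assms(1), of _ "arrows G"]
  have "objects G \<subseteq> arrows G" by (auto simp: objects_def)
  then have s: "(\<Oplus>\<^bsub>free_algebra K (arrows G)\<^esub>e\<in>objects G. basis_vector K [e])
      \<in> carrier (free_algebra K (arrows G))"
    by (intro F.M.finsum_closed) (auto intro: b)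
  have c: "g \<in> arrows G \<and> h \<in> arrows G \<and> g \<cdot>\<^bsub>G\<^esub> h \<in> arrows G"
    if "(g, h) \<in> composable G" for g h
    using that G.gmult_closed by (auto simp: composable_def)
  show ?thesis
    unfolding par_relators_def Let_def
    by (auto dest!: c intro!: b s F.M.minus_closed F.M.m_closed F.M.one_closed
        G.ginv_closed G.gmult_closed G.dm_closed G.rn_closed)
qed

theorem assoc_algebra_partial_groupoid_algebra:
  assumes "field K" "groupoid G"
  shows "assoc_algebra K (partial_groupoid_algebra K G)"
proof -
  interpret F: assoc_algebra K "free_algebra K (arrows G)"
    by (rule assoc_algebra_free_algebra) fact
  show ?thesis unfolding partial_groupoid_algebra_def Let_def
    by (intro assoc_algebra_quot_algebra F.M.genideal_ideal par_relators_subset assms 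
        F.assoc_algebra_axioms)
qed

end

theory Submission
  imports Defs
begin

text \<open>
  Write \<open>F\<close> for the free algebra on the arrows of \<open>G\<close>, \<open>B\<close> for the groupoid algebra of the
  Birget-Rhodes expansion and \<open>P = F / I\<close> for the partial groupoid algebra, with quotient map
  \<open>\<pi>\<close>.  The isomorphism is induced by the homomorphism \<open>\<Phi> : F \<rightarrow> B\<close> that sends \<open>[g]\<close> to the sum
  of all arrows \<open>(A, g)\<close> over \<open>g\<close> (\<open>arrow_sum\<close>).  By the first isomorphism theorem
  (\<open>algebra_isomorphic_quot_algebra\<close>) it suffices that \<open>\<Phi>\<close> is onto and that its kernel is \<open>I\<close>.

  A product of arrow sums is an indicator function: it sums the \<open>(A, k)\<close> whose second component
  is the product in \<open>G\<close> and whose first component contains certain arrows.  Comparing these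
  conditions shows that the arrow sums satisfy the relations of \<open>P\<close>
  (\<open>partial_representation_arrow_sum\<close>, \<open>sum_arrow_sum_objects\<close>), so \<open>I\<close> lies in the kernel.  Each
  single condition \<open>x \<in> A\<close> or \<open>x \<notin> A\<close> can be imposed by multiplying and subtracting, and all of
  them together determine \<open>A\<close>; hence \<open>\<Phi>\<close> is onto (\<open>arrow_sums_generate\<close>).

  For the other inclusion of the kernel a linear map \<open>\<Psi> : B \<rightarrow> P\<close> with \<open>\<Psi> \<circ> \<Phi> = \<pi>\<close> is constructed.
  In \<open>P\<close> the elements \<open>\<epsilon> x = [x] [x\<inverse>]\<close> are idempotents, and those with a common range commute
  (\<open>\<epsilon>_comm\<close>).  For an object \<open>e\<close> they therefore split \<open>1\<close> into orthogonal atoms indexed by the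
  sets \<open>A\<close> of arrows that end at \<open>e\<close>: the products of the \<open>\<epsilon> x\<close> for \<open>x \<in> A\<close> and the \<open>1 - \<epsilon> x\<close> for
  \<open>x \<notin> A\<close>.  Let \<open>\<Psi> (A, g) = \<tau> (A, g)\<close> be \<open>[g]\<close> times the atom of \<open>A\<close>.  The product \<open>[h] \<tau> (A, g)\<close> is
  \<open>\<tau> (A, h g)\<close> or \<open>0\<close> in exactly the same cases in which the product of \<open>arrow_sum h\<close> and
  \<open>(A, g)\<close> is \<open>(A, h g)\<close> or \<open>0\<close> (\<open>\<sigma>_mult_\<tau>\<close>, \<open>arrow_sum_mult_basis_vector\<close>), and the \<open>\<tau> (A, g)\<close> with
  fixed \<open>g\<close> add up to \<open>[g]\<close> (\<open>sum_\<tau>\<close>).  An induction on words then gives \<open>\<Psi> \<circ> \<Phi> = \<pi>\<close>.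
\<close>

section \<open>Linear extension from a basis\<close>

lemma (in abelian_group_hom) hom_finsum:
  "f \<in> I \<rightarrow> carrier G \<Longrightarrow> h (\<Oplus>\<^bsub>G\<^esub>i\<in>I. f i) = (\<Oplus>\<^bsub>H\<^esub>i\<in>I. h (f i))"
proof (induction I rule: infinite_finite_induct)
  case (insert i I)
  then have "f i \<in> carrier G" "f \<in> I \<rightarrow> carrier G" "(\<lambda>i. h (f i)) \<in> I \<rightarrow> carrier H"
    by (auto intro: hom_closed)
  then show ?case using insert by simp
qed simp_all

context partial_semigroup_basis
begin

lemma basis_vector_in_carrier: "s \<in> S \<Longrightarrow> basis_vector K s \<in> carrier BA"
  by (auto simp: BA_carrier basis_vector_def supp_def)

lemma basis_vector_mult:
  assumes "y \<in> S" "z \<in> S"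
  shows "basis_vector K y \<otimes>\<^bsub>BA\<^esub> basis_vector K z =
    (case p y z of None \<Rightarrow> \<zero>\<^bsub>BA\<^esub> | Some x \<Rightarrow> basis_vector K x)"
proof
  fix x
  have "(basis_vector K y \<otimes>\<^bsub>BA\<^esub> basis_vector K z) x =
      (\<Oplus>a\<in>{y}. \<Oplus>b\<in>{z}. if p a b = Some x then basis_vector K y a \<otimes> basis_vector K z b else \<zero>)"
    by (rule BA_mult)
      (use assms in \<open>simp_all add: basis_vector_in_carrier\<close>, auto simp: supp_def basis_vector_def)
  then show "(basis_vector K y \<otimes>\<^bsub>BA\<^esub> basis_vector K z) x =
      (case p y z of None \<Rightarrow> \<zero>\<^bsub>BA\<^esub> | Some x \<Rightarrow> basis_vector K x) x"
    by (auto simp: basis_vector_def BA_simps split: option.split)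
qed

text \<open>
  Linear maps out of \<open>BA\<close> have to be compared on multiples of basis vectors only.  The induction
  is on the size of the support: overwriting one coefficient with \<open>\<zero>\<close> removes one point of it.
\<close>

lemma BA_induct [consumes 1, case_names zero scaled_basis add]:
  assumes "f \<in> carrier BA"
    and "P \<zero>\<^bsub>BA\<^esub>"
    and scaled: "\<And>c s. c \<in> carrier K \<Longrightarrow> s \<in> S \<Longrightarrow> P (c \<odot>\<^bsub>BA\<^esub> basis_vector K s)"
    and add: "\<And>f g. f \<in> carrier BA \<Longrightarrow> g \<in> carrier BA \<Longrightarrow> P f \<Longrightarrow> P g \<Longrightarrow> P (f \<oplus>\<^bsub>BA\<^esub> g)"
  shows "P f"
  using assms(1)
proof (induction "card (supp K f)" arbitrary: f)
  case 0
  then have "f = \<zero>\<^bsub>BA\<^esub>" by (auto simp: BA_carrier supp_def BA_simps)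
  then show ?case using assms(2) by simp
next
  case (Suc n)
  from Suc.hyps(2) obtain s where s: "s \<in> supp K f" by fastforce
  have f: "f x \<in> carrier K" for x using Suc.prems by (simp add: BA_carrier)
  have sS: "s \<in> S" using s Suc.prems by (auto simp: BA_carrier)
  let ?g = "f(s := \<zero>)"
  have supp_g: "supp K ?g = supp K f - {s}" by (auto simp: supp_def)
  have g: "?g \<in> carrier BA" using Suc.prems supp_g by (auto simp: BA_carrier)
  have c: "f s \<odot>\<^bsub>BA\<^esub> basis_vector K s \<in> carrier BA"
    by (intro BA_smult_closed f basis_vector_in_carrier sS)
  have "card (supp K ?g) = n" using Suc.hyps(2) s supp_g by simp
  then have "P ?g" using Suc.hyps(1) g by blast
  moreover have "P (f s \<odot>\<^bsub>BA\<^esub> basis_vector K s)" by (rule scaled[OF f sS])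
  moreover have "f = ?g \<oplus>\<^bsub>BA\<^esub> f s \<odot>\<^bsub>BA\<^esub> basis_vector K s"
    using f by (auto simp: BA_simps basis_vector_def)
  ultimately show ?case using add[OF g c] by simp
qed

text \<open>
  The sum runs over the support and not over \<open>S\<close>, because \<open>S\<close> may be infinite, as it is for the
  words of a free algebra, and a sum over an infinite set has a default value.
\<close>

definition linear_extension :: "('a, 'c, 'd) module_scheme \<Rightarrow> ('s \<Rightarrow> 'c) \<Rightarrow> ('s \<Rightarrow> 'a) \<Rightarrow> 'c" where
  "linear_extension M t f = (\<Oplus>\<^bsub>M\<^esub>x\<in>supp K f. f x \<odot>\<^bsub>M\<^esub> t x)"

context
  fixes M :: "('a, 'c, 'd) module_scheme" and t :: "'s \<Rightarrow> 'c"
  assumes M: "module K M" and t: "t \<in> S \<rightarrow> carrier M"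
begin

interpretation M: module K M by (rule M)

lemma linear_extension_superset:
  assumes f: "f \<in> carrier BA" and X: "finite X" "supp K f \<subseteq> X" "X \<subseteq> S"
  shows "linear_extension M t f = (\<Oplus>\<^bsub>M\<^esub>x\<in>X. f x \<odot>\<^bsub>M\<^esub> t x)"
  unfolding linear_extension_def
proof (rule M.finsum_neutral_sub[OF X(1,2)])
  fix b assume "b \<in> X - supp K f"
  then have "f b = \<zero>" "t b \<in> carrier M" using X t by (auto simp: supp_def)
  then show "f b \<odot>\<^bsub>M\<^esub> t b = \<zero>\<^bsub>M\<^esub>" by simp
next
  fix b assume "b \<in> X"
  then have "f b \<in> carrier K" "t b \<in> carrier M" using f X t by (auto simp: BA_carrier)
  then show "f b \<odot>\<^bsub>M\<^esub> t b \<in> carrier M" by simp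
qed

lemma linear_extension_closed:
  "f \<in> carrier BA \<Longrightarrow> linear_extension M t f \<in> carrier M"
  unfolding linear_extension_def using t by (intro M.finsum_closed) (auto simp: BA_carrier)

lemma linear_extension_add:
  assumes f: "f \<in> carrier BA" and g: "g \<in> carrier BA"
  shows "linear_extension M t (f \<oplus>\<^bsub>BA\<^esub> g) = linear_extension M t f \<oplus>\<^bsub>M\<^esub> linear_extension M t g"
proof -
  interpret A: abelian_group BA by (rule BA_abelian_group)
  let ?X = "supp K f \<union> supp K g"
  have X: "finite ?X" "?X \<subseteq> S" and c: "f x \<in> carrier K" "g x \<in> carrier K" for x
    using f g by (auto simp: BA_carrier)
  have tX: "t x \<in> carrier M" if "x \<in> ?X" for x using that X t by auto
  have "linear_extension M t (f \<oplus>\<^bsub>BA\<^esub> g) = (\<Oplus>\<^bsub>M\<^esub>x\<in>?X. (f \<oplus>\<^bsub>BA\<^esub> g) x \<odot>\<^bsub>M\<^esub> t x)"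
    by (rule linear_extension_superset) (use f g X in \<open>auto simp: supp_def BA_simps\<close>)
  also have "\<dots> = (\<Oplus>\<^bsub>M\<^esub>x\<in>?X. f x \<odot>\<^bsub>M\<^esub> t x \<oplus>\<^bsub>M\<^esub> g x \<odot>\<^bsub>M\<^esub> t x)"
    using c tX by (intro M.finsum_cong') (auto simp: BA_simps M.smult_l_distr)
  also have "\<dots> = (\<Oplus>\<^bsub>M\<^esub>x\<in>?X. f x \<odot>\<^bsub>M\<^esub> t x) \<oplus>\<^bsub>M\<^esub> (\<Oplus>\<^bsub>M\<^esub>x\<in>?X. g x \<odot>\<^bsub>M\<^esub> t x)"
    using c tX by (intro M.finsum_addf) auto
  also have "\<dots> = linear_extension M t f \<oplus>\<^bsub>M\<^esub> linear_extension M t g"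
    using linear_extension_superset[OF f X(1) _ X(2)] linear_extension_superset[OF g X(1) _ X(2)]
    by simp
  finally show ?thesis .
qed

lemma linear_extension_smult:
  assumes f: "f \<in> carrier BA" and c: "c \<in> carrier K"
  shows "linear_extension M t (c \<odot>\<^bsub>BA\<^esub> f) = c \<odot>\<^bsub>M\<^esub> linear_extension M t f"
proof -
  have X: "finite (supp K f)" "supp K f \<subseteq> S" and fK: "f x \<in> carrier K" for x
    using f by (auto simp: BA_carrier)
  have tX: "t x \<in> carrier M" if "x \<in> supp K f" for x using that X t by auto
  have "linear_extension M t (c \<odot>\<^bsub>BA\<^esub> f) = (\<Oplus>\<^bsub>M\<^esub>x\<in>supp K f. (c \<odot>\<^bsub>BA\<^esub> f) x \<odot>\<^bsub>M\<^esub> t x)"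
    by (rule linear_extension_superset)
      (use f c X in \<open>auto simp: supp_def BA_simps BA_smult_closed\<close>)
  also have "\<dots> = (\<Oplus>\<^bsub>M\<^esub>x\<in>supp K f. c \<odot>\<^bsub>M\<^esub> (f x \<odot>\<^bsub>M\<^esub> t x))"
    using c fK tX by (intro M.finsum_cong') (auto simp: BA_simps M.smult_assoc1)
  also have "\<dots> = c \<odot>\<^bsub>M\<^esub> linear_extension M t f"
    unfolding linear_extension_def using c fK tX X
    by (intro M.finsum_smult_ldistr[symmetric]) auto
  finally show ?thesis .
qed

lemma linear_extension_basis_vector:
  assumes "s \<in> S"
  shows "linear_extension M t (basis_vector K s) = t s"
proof -
  have "t s \<in> carrier M" using assms t by auto
  moreover have "linear_extension M t (basis_vector K s) =
      (\<Oplus>\<^bsub>M\<^esub>x\<in>{s}. basis_vector K s x \<odot>\<^bsub>M\<^esub> t x)"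
    by (rule linear_extension_superset)
      (use assms basis_vector_in_carrier in \<open>auto simp: supp_def basis_vector_def\<close>)
  ultimately show ?thesis by (simp add: basis_vector_def)
qed

lemma linear_extension_group_hom: "abelian_group_hom BA M (linear_extension M t)"
proof (rule abelian_group_homI)
  show "abelian_group BA" by (rule BA_abelian_group)
  show "abelian_group M" by (rule M.abelian_group_axioms)
  show "group_hom (add_monoid BA) (add_monoid M) (linear_extension M t)"
    using linear_extension_closed linear_extension_add
    by (simp add: group_hom_def group_hom_axioms_def hom_def BA_abelian_group
        abelian_group.a_group M.a_group)
qed

end

text \<open>
  Multiplication is bilinear on both sides, so multiplicativity spreads from pairs of basis
  vectors to one arbitrary factor and then to both.
\<close>

lemma linear_extension_ring_hom:
  assumes M: "assoc_algebra K M" and t: "t \<in> S \<rightarrow> carrier M"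
    and t_mult: "\<And>y z. y \<in> S \<Longrightarrow> z \<in> S \<Longrightarrow>
      t y \<otimes>\<^bsub>M\<^esub> t z = (case p y z of None \<Rightarrow> \<zero>\<^bsub>M\<^esub> | Some x \<Rightarrow> t x)"
    and t_one: "(\<Oplus>\<^bsub>M\<^esub>u\<in>U. t u) = \<one>\<^bsub>M\<^esub>"
  shows "linear_extension M t \<in> ring_hom BA M"
proof -
  interpret A: assoc_algebra K BA by (rule assoc_algebra_BA)
  interpret M: assoc_algebra K M by (rule M)
  note Mt = M.module_axioms t
  let ?L = "linear_extension M t"
  interpret L: abelian_group_hom BA M ?L by (rule linear_extension_group_hom[OF Mt])
  note L_simps = linear_extension_smult[OF Mt] linear_extension_basis_vector[OF Mt]
    basis_vector_in_carrier
  have tM: "t s \<in> carrier M" if "s \<in> S" for s using t that by auto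
  have basis: "?L (basis_vector K y \<otimes>\<^bsub>BA\<^esub> basis_vector K z) = t y \<otimes>\<^bsub>M\<^esub> t z"
    if "y \<in> S" "z \<in> S" for y z
    using that p_closed[OF that] by (cases "p y z") (simp_all add: basis_vector_mult t_mult L_simps)
  have left: "?L (basis_vector K y \<otimes>\<^bsub>BA\<^esub> g) = t y \<otimes>\<^bsub>M\<^esub> ?L g"
    if y: "y \<in> S" and g: "g \<in> carrier BA" for y g
    using g
  proof (induction g rule: BA_induct)
    case zero
    then show ?case using y tM by (simp add: L_simps)
  next
    case (scaled_basis c s)
    then show ?case using y tM
      by (simp add: A.smult_mult_right M.smult_mult_right L_simps basis)
  next
    case (add f g)
    then show ?case using y tM
      by (simp add: A.M.r_distr M.M.r_distr L_simps)
  qed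
  have mult: "?L (f \<otimes>\<^bsub>BA\<^esub> g) = ?L f \<otimes>\<^bsub>M\<^esub> ?L g"
    if f: "f \<in> carrier BA" and g: "g \<in> carrier BA" for f g
    using f
  proof (induction f rule: BA_induct)
    case zero
    then show ?case using g by simp
  next
    case (scaled_basis c s)
    then show ?case using g tM
      by (simp add: A.smult_mult_left M.smult_mult_left L_simps left)
  next
    case (add f f')
    then show ?case using g by (simp add: A.M.l_distr M.M.l_distr)
  qed
  have "?L \<one>\<^bsub>BA\<^esub> = (\<Oplus>\<^bsub>M\<^esub>u\<in>U. \<one>\<^bsub>BA\<^esub> u \<odot>\<^bsub>M\<^esub> t u)"
    by (rule linear_extension_superset[OF Mt])
      (use U_finite U_sub in \<open>auto simp: supp_def BA_simps\<close>)
  also have "\<dots> = (\<Oplus>\<^bsub>M\<^esub>u\<in>U. t u)"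
    using U_sub tM by (intro M.M.finsum_cong') (auto simp: BA_simps)
  finally have "?L \<one>\<^bsub>BA\<^esub> = \<one>\<^bsub>M\<^esub>" using t_one by simp
  then show ?thesis by (intro ring_hom_memI) (simp_all add: mult)
qed

end

lemma partial_semigroup_basis_groupoid:
  assumes "cring K" "groupoid H" "finite (arrows H)"
  shows "partial_semigroup_basis K (arrows H)
    (\<lambda>g h. if dm H g = rn H h then Some (gmult H g h) else None) (objects H)"
proof -
  interpret cring K by fact
  interpret H: groupoid H by fact
  have obj: "v \<in> arrows H \<and> dm H v = v \<and> rn H v = v" if "v \<in> objects H" for v
    using that H.rn_dm[of v] by (auto simp: objects_def)
  have ids: "dm H x \<in> objects H" "rn H x \<in> objects H" if "x \<in> arrows H" for x
    using that by (simp_all add: objects_def H.dm_closed H.rn_closed H.dm_dm H.dm_rn)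
  show ?thesis
  proof unfold_locales
    fix x assume x: "x \<in> arrows H"
    show "\<exists>u\<in>objects H. (if dm H u = rn H x then Some (gmult H u x) else None) = Some x \<and>
        (\<forall>v\<in>objects H. v \<noteq> u \<longrightarrow> (if dm H v = rn H x then Some (gmult H v x) else None) = None)"
      using x by (intro bexI[of _ "rn H x"]) (simp_all add: obj ids H.left_id H.dm_rn)
    show "\<exists>u\<in>objects H. (if dm H x = rn H u then Some (gmult H x u) else None) = Some x \<and>
        (\<forall>v\<in>objects H. v \<noteq> u \<longrightarrow> (if dm H x = rn H v then Some (gmult H x v) else None) = None)"
      using x by (intro bexI[of _ "dm H x"]) (auto simp: obj ids H.right_id H.rn_dm)
  next
    show "finite (objects H)" using assms(3) by (simp add: objects_def)
  qed (auto simp: composable_def objects_def H.dm_gmult H.rn_gmult H.gmult_closed H.gmult_assoc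
      split: if_splits)
qed

lemma partial_semigroup_basis_words:
  "cring K \<Longrightarrow> partial_semigroup_basis K (lists X) (\<lambda>v w. Some (v @ w)) {[]}"
  by (simp add: partial_semigroup_basis_def partial_semigroup_basis_axioms_def)

fun word_product :: "('b, 'r) ring_scheme \<Rightarrow> ('a \<Rightarrow> 'b) \<Rightarrow> 'a list \<Rightarrow> 'b" where
  "word_product M \<sigma> [] = \<one>\<^bsub>M\<^esub>"
| "word_product M \<sigma> (x # w) = \<sigma> x \<otimes>\<^bsub>M\<^esub> word_product M \<sigma> w"

lemma (in ring) word_product_closed:
  "\<sigma> \<in> X \<rightarrow> carrier R \<Longrightarrow> w \<in> lists X \<Longrightarrow> word_product R \<sigma> w \<in> carrier R"
  by (induction w) auto

lemma (in ring) word_product_append: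
  assumes \<sigma>: "\<sigma> \<in> X \<rightarrow> carrier R" and "v \<in> lists X" and w: "w \<in> lists X"
  shows "word_product R \<sigma> (v @ w) = word_product R \<sigma> v \<otimes> word_product R \<sigma> w"
  using assms(2)
proof (induction v)
  case Nil
  then show ?case using word_product_closed[OF \<sigma> w] by simp
next
  case (Cons x v)
  then have "\<sigma> x \<in> carrier R" "word_product R \<sigma> v \<in> carrier R"
    using \<sigma> word_product_closed[OF \<sigma>] by auto
  then show ?case using Cons word_product_closed[OF \<sigma> w] by (simp add: m_assoc)
qed

lemma free_algebra_hom:
  assumes K: "field K" and M: "assoc_algebra K M" and \<sigma>: "\<sigma> \<in> X \<rightarrow> carrier M"
  obtains \<Phi> where "\<Phi> \<in> ring_hom (free_algebra K X) M"
    "\<And>c f. c \<in> carrier K \<Longrightarrow> f \<in> carrier (free_algebra K X)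
      \<Longrightarrow> \<Phi> (c \<odot>\<^bsub>free_algebra K X\<^esub> f) = c \<odot>\<^bsub>M\<^esub> \<Phi> f"
    "\<And>w. w \<in> lists X \<Longrightarrow> \<Phi> (basis_vector K w) = word_product M \<sigma> w"
proof -
  interpret K: field K by (rule K)
  interpret M: assoc_algebra K M by (rule M)
  interpret words: partial_semigroup_basis K "lists X" "\<lambda>v w. Some (v @ w)" "{[]}"
    by (rule partial_semigroup_basis_words) (rule K.is_cring)
  have F: "free_algebra K X = words.BA" by (simp add: free_algebra_def)
  have t: "word_product M \<sigma> \<in> lists X \<rightarrow> carrier M" using M.M.word_product_closed[OF \<sigma>] by auto
  let ?L = "words.linear_extension M (word_product M \<sigma>)"
  have "?L \<in> ring_hom words.BA M"
    using M t by (rule words.linear_extension_ring_hom)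
      (simp_all add: M.M.word_product_append[OF \<sigma>])
  then show ?thesis
    using words.linear_extension_smult[OF M.module_axioms t]
      words.linear_extension_basis_vector[OF M.module_axioms t]
    by (intro that[of ?L, unfolded F])
qed

section \<open>Quotients by kernels\<close>

text \<open>
  The union in the definition of the scalar action has equal members, because a two-sided ideal
  is stable under scalars: \<open>c \<odot> i = (c \<odot> \<one>) \<otimes> i\<close>.
\<close>

lemma quot_algebra_smult_coset:
  assumes A: "assoc_algebra K A" and I: "ideal I A" and c: "c \<in> carrier K" and a: "a \<in> carrier A"
  shows "c \<odot>\<^bsub>quot_algebra A I\<^esub> (I +>\<^bsub>A\<^esub> a) = I +>\<^bsub>A\<^esub> (c \<odot>\<^bsub>A\<^esub> a)"
proof -
  interpret assoc_algebra K A by (rule A)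
  interpret I: ideal I A by (rule I)
  have "I +>\<^bsub>A\<^esub> (c \<odot>\<^bsub>A\<^esub> b) = I +>\<^bsub>A\<^esub> (c \<odot>\<^bsub>A\<^esub> a)" if b: "b \<in> I +>\<^bsub>A\<^esub> a" for b
  proof -
    obtain i where i: "i \<in> I" "b = i \<oplus>\<^bsub>A\<^esub> a" using b by (auto simp: a_r_coset_def')
    have iA: "i \<in> carrier A" using i I.a_subset by auto
    have "c \<odot>\<^bsub>A\<^esub> i = (c \<odot>\<^bsub>A\<^esub> \<one>\<^bsub>A\<^esub>) \<otimes>\<^bsub>A\<^esub> i"
      using c iA smult_mult_left[of c "\<one>\<^bsub>A\<^esub>" i] by simp
    then have "c \<odot>\<^bsub>A\<^esub> i \<in> I" using I.I_l_closed[OF i(1)] c by simp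
    then have "c \<odot>\<^bsub>A\<^esub> b \<in> I +>\<^bsub>A\<^esub> (c \<odot>\<^bsub>A\<^esub> a)"
      using i iA a c by (auto simp: a_r_coset_def' smult_r_distr)
    then show ?thesis using I.a_repr_independence'[of "c \<odot>\<^bsub>A\<^esub> b" "c \<odot>\<^bsub>A\<^esub> a"] a c by simp
  qed
  moreover have "a \<in> I +>\<^bsub>A\<^esub> a" using I.a_rcos_self a by simp
  ultimately have "(\<Union>b\<in>I +>\<^bsub>A\<^esub> a. I +>\<^bsub>A\<^esub> (c \<odot>\<^bsub>A\<^esub> b)) = I +>\<^bsub>A\<^esub> (c \<odot>\<^bsub>A\<^esub> a)"
    by blast
  then show ?thesis by (simp add: quot_algebra_def)
qed

text \<open>
  The first isomorphism theorem with scalars: the ring isomorphism induced by \<open>\<Phi>\<close> maps the coset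
  of \<open>a\<close> to \<open>\<Phi> a\<close>, so its inverse commutes with scalars because \<open>\<Phi>\<close> does.
\<close>

theorem algebra_isomorphic_quot_algebra:
  assumes A: "assoc_algebra K A" and B: "ring B"
    and \<Phi>: "\<Phi> \<in> ring_hom A B"
    and lin: "\<And>c a. c \<in> carrier K \<Longrightarrow> a \<in> carrier A \<Longrightarrow> \<Phi> (c \<odot>\<^bsub>A\<^esub> a) = c \<odot>\<^bsub>B\<^esub> \<Phi> a"
    and surj: "carrier B \<subseteq> \<Phi> ` carrier A"
    and ker: "a_kernel A B \<Phi> = I"
  shows "algebra_isomorphic K B (quot_algebra A I)"
proof -
  interpret A: assoc_algebra K A by (rule A)
  interpret B: ring B by (rule B)
  interpret h: ring_hom_ring A B \<Phi> by (rule ring_hom_ringI2) (use A.M.ring_axioms B \<Phi> in auto)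
  have I: "ideal I A" using h.kernel_is_ideal ker by simp
  let ?Q = "A Quot I" and ?\<theta> = "\<lambda>X. the_elem (\<Phi> ` X)"
  have "\<Phi> ` carrier A = carrier B" using surj by auto
  then have iso: "?\<theta> \<in> ring_iso ?Q B" using h.FactRing_iso_set ker by simp
  have rQ: "ring ?Q" using I by (rule ideal.quotient_is_ring)
  let ?\<psi> = "inv_into (carrier ?Q) ?\<theta>"
  have \<psi>: "?\<psi> \<in> ring_iso B ?Q" by (rule ring_iso_set_sym[OF rQ iso])
  have inj: "inj_on ?\<theta> (carrier ?Q)" using iso by (simp add: ring_iso_def bij_betw_def)
  have \<psi>_eq: "?\<psi> (\<Phi> a) = I +>\<^bsub>A\<^esub> a" if a: "a \<in> carrier A" for a
  proof -
    have "I +>\<^bsub>A\<^esub> a \<in> carrier ?Q" using a by (auto simp: FactRing_simps)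
    moreover have "?\<theta> (I +>\<^bsub>A\<^esub> a) = \<Phi> a" using h.the_elem_simp[OF a] ker by simp
    ultimately show ?thesis using inj by (metis inv_into_f_f)
  qed
  have "?\<psi> (c \<odot>\<^bsub>B\<^esub> b) = c \<odot>\<^bsub>quot_algebra A I\<^esub> ?\<psi> b"
    if c: "c \<in> carrier K" and b: "b \<in> carrier B" for c b
  proof -
    obtain a where a: "a \<in> carrier A" "b = \<Phi> a" using surj b by auto
    then have "c \<odot>\<^bsub>B\<^esub> b = \<Phi> (c \<odot>\<^bsub>A\<^esub> a)" using lin c by simp
    then show ?thesis
      using a c quot_algebra_smult_coset[OF A I c a(1)] by (simp add: \<psi>_eq A.smult_closed)
  qed
  moreover have "?\<psi> \<in> ring_iso B (quot_algebra A I)"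
    using \<psi> by (auto simp: ring_iso_def ring_hom_def quot_algebra_def)
  ultimately show ?thesis unfolding algebra_isomorphic_def by blast
qed

section \<open>Arrows of a groupoid and of its expansion\<close>

lemma composable_iff:
  "(g, h) \<in> composable G \<longleftrightarrow> g \<in> arrows G \<and> h \<in> arrows G \<and> dm G g = rn G h"
  by (auto simp: composable_def)

lemmas (in groupoid) arrow_simps = ginv_closed dm_ginv rn_ginv ginv_gmult gmult_ginv dm_gmult
  rn_gmult gmult_closed dm_closed rn_closed dm_dm rn_dm dm_rn rn_rn
  right_id left_id ginv_ginv ginv_dm ginv_rn

lemma (in groupoid) object_simps:
  assumes "e \<in> objects G"
  shows "e \<in> arrows G" "dm G e = e" "rn G e = e" "ginv G e = e"
  using assms rn_dm[of e] ginv_dm[of e] by (auto simp: objects_def)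

lemma (in groupoid) ginv_gmult_gmult:
  assumes "(g, h) \<in> composable G"
  shows "ginv G g \<cdot> (g \<cdot> h) = h"
proof -
  have "(ginv G g, g) \<in> composable G" using assms by (auto simp: composable_def ginv_closed dm_ginv)
  from gmult_assoc[OF this assms] show ?thesis
    using assms left_id[of h] by (auto simp: composable_def ginv_gmult)
qed

lemma (in groupoid) gmult_ginv_gmult:
  assumes "g \<in> arrows G" "h \<in> arrows G" "rn G h = rn G g"
  shows "g \<cdot> (ginv G g \<cdot> h) = h"
  using ginv_gmult_gmult[of "ginv G g" h] assms
  by (simp add: composable_def ginv_closed dm_ginv ginv_ginv)

lemma (in groupoid) arrows_into_dm_gmult:
  "(g, h) \<in> composable G \<Longrightarrow> arrows_into_dm G (g \<cdot> h) = arrows_into_dm G h"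
  by (simp add: arrows_into_dm_def dm_gmult)

lemma arrow_birget_rhodes_iff:
  "(A, g) \<in> arrows (birget_rhodes G) \<longleftrightarrow>
    g \<in> arrows G \<and> A \<subseteq> arrows_into_dm G g \<and> dm G g \<in> A \<and> ginv G g \<in> A"
  by (simp add: birget_rhodes_def)

section \<open>Partial representations\<close>

text \<open>
  The defining relations of \<open>K\<^sub>p\<^sub>a\<^sub>r(G)\<close>, except the one for the unit, for a family of elements of an
  arbitrary ring.  Both algebras of the isomorphism carry such a family.
\<close>

locale partial_representation = G: groupoid G + M: ring M for G and M (structure) +
  fixes \<sigma>
  assumes \<sigma>_closed [simp]: "g \<in> arrows G \<Longrightarrow> \<sigma> g \<in> carrier M"
    and \<sigma>_ginv_mult_mult: "(g, h) \<in> composable G \<Longrightarrow>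
      \<sigma> (ginv G g) \<otimes> \<sigma> g \<otimes> \<sigma> h = \<sigma> (ginv G g) \<otimes> \<sigma> (gmult G g h)"
    and \<sigma>_mult_mult_ginv: "(g, h) \<in> composable G \<Longrightarrow>
      \<sigma> g \<otimes> \<sigma> h \<otimes> \<sigma> (ginv G h) = \<sigma> (gmult G g h) \<otimes> \<sigma> (ginv G h)"
    and \<sigma>_rn: "g \<in> arrows G \<Longrightarrow> \<sigma> (rn G g) \<otimes> \<sigma> g = \<sigma> g"
    and \<sigma>_dm: "g \<in> arrows G \<Longrightarrow> \<sigma> g \<otimes> \<sigma> (dm G g) = \<sigma> g"
    and \<sigma>_zero: "g \<in> arrows G \<Longrightarrow> h \<in> arrows G \<Longrightarrow> (g, h) \<notin> composable G \<Longrightarrow> \<sigma> g \<otimes> \<sigma> h = \<zero>"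
begin

definition \<epsilon> where
  "\<epsilon> g = \<sigma> g \<otimes> \<sigma> (ginv G g)"

lemma \<epsilon>_closed [simp]: "g \<in> arrows G \<Longrightarrow> \<epsilon> g \<in> carrier M"
  by (simp add: \<epsilon>_def G.arrow_simps)

lemma \<epsilon>_mult_\<sigma>: "g \<in> arrows G \<Longrightarrow> \<epsilon> g \<otimes> \<sigma> g = \<sigma> g"
  using \<sigma>_ginv_mult_mult[of "ginv G g" g] by (simp add: \<epsilon>_def composable_iff G.arrow_simps \<sigma>_dm)

lemma \<sigma>_mult_\<epsilon>_ginv: "g \<in> arrows G \<Longrightarrow> \<sigma> g \<otimes> \<epsilon> (ginv G g) = \<sigma> g"
  using \<epsilon>_mult_\<sigma>[of g] by (simp add: \<epsilon>_def G.arrow_simps M.m_assoc)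

lemma \<epsilon>_idem: "g \<in> arrows G \<Longrightarrow> \<epsilon> g \<otimes> \<epsilon> g = \<epsilon> g"
  using \<epsilon>_mult_\<sigma>[of g] by (simp add: \<epsilon>_def G.arrow_simps flip: M.m_assoc)

text \<open>
  Moving an idempotent past \<open>\<sigma> g\<close> translates it by \<open>g\<close>.  With \<open>k = g h\<close>, inserting
  \<open>\<sigma> k = \<sigma> k \<otimes> \<sigma> k\<inverse> \<otimes> \<sigma> k\<close> allows the first relation to be applied to the pair \<open>(k, h\<inverse>)\<close>, whose
  product is \<open>g\<close>.
\<close>

lemma \<sigma>_mult_\<epsilon>:
  assumes "(g, h) \<in> composable G"
  shows "\<sigma> g \<otimes> \<epsilon> h = \<epsilon> (gmult G g h) \<otimes> \<sigma> g"
proof -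
  have gh: "g \<in> arrows G" "h \<in> arrows G" "dm G g = rn G h"
    using assms by (auto simp: composable_iff)
  let ?k = "gmult G g h"
  have k: "?k \<in> arrows G" "dm G ?k = dm G h" "rn G ?k = rn G g"
    using assms by (simp_all add: G.arrow_simps)
  have c: "(?k, ginv G h) \<in> composable G" "(h, ginv G h) \<in> composable G"
    using gh k by (simp_all add: composable_iff G.arrow_simps)
  have kh: "gmult G ?k (ginv G h) = g"
    using G.gmult_assoc[OF assms c(2)] G.right_id[OF gh(1)] gh by (simp add: G.arrow_simps)
  have "\<sigma> g \<otimes> \<epsilon> h = \<sigma> ?k \<otimes> \<sigma> (ginv G h)"
    using \<sigma>_mult_mult_ginv[OF assms] gh by (simp add: \<epsilon>_def M.m_assoc G.arrow_simps)
  also have "\<dots> = \<epsilon> ?k \<otimes> \<sigma> ?k \<otimes> \<sigma> (ginv G h)"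
    using k by (simp add: \<epsilon>_mult_\<sigma>)
  also have "\<dots> = \<sigma> ?k \<otimes> (\<sigma> (ginv G ?k) \<otimes> \<sigma> ?k \<otimes> \<sigma> (ginv G h))"
    using gh k by (simp add: \<epsilon>_def M.m_assoc G.arrow_simps)
  also have "\<dots> = \<sigma> ?k \<otimes> (\<sigma> (ginv G ?k) \<otimes> \<sigma> g)"
    using \<sigma>_ginv_mult_mult[OF c(1)] kh by simp
  also have "\<dots> = \<epsilon> ?k \<otimes> \<sigma> g"
    using gh k by (simp add: \<epsilon>_def M.m_assoc G.arrow_simps)
  finally show ?thesis .
qed

text \<open>
  Translating \<open>\<epsilon> h\<close> by \<open>g\<inverse>\<close> and then back by \<open>g\<close> carries it past both factors of
  \<open>\<epsilon> g = \<sigma> g \<otimes> \<sigma> g\<inverse>\<close> and leaves it unchanged.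
\<close>

lemma \<epsilon>_comm:
  assumes g: "g \<in> arrows G" and h: "h \<in> arrows G" and r: "rn G g = rn G h"
  shows "\<epsilon> g \<otimes> \<epsilon> h = \<epsilon> h \<otimes> \<epsilon> g"
proof -
  let ?k = "gmult G (ginv G g) h"
  have c: "(ginv G g, h) \<in> composable G" using assms by (simp add: composable_iff G.arrow_simps)
  have k: "?k \<in> arrows G" "rn G ?k = dm G g" using c g by (simp_all add: G.arrow_simps)
  have ck: "(g, ?k) \<in> composable G" "(g, ginv G g) \<in> composable G"
    using g k by (simp_all add: composable_iff G.arrow_simps)
  have gk: "gmult G g ?k = h"
    using G.gmult_assoc[OF ck(2) c] G.left_id[OF h] g r by (simp add: G.arrow_simps)
  have "\<epsilon> g \<otimes> \<epsilon> h = \<sigma> g \<otimes> (\<sigma> (ginv G g) \<otimes> \<epsilon> h)"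
    using g h by (simp add: \<epsilon>_def M.m_assoc G.arrow_simps)
  also have "\<dots> = (\<sigma> g \<otimes> \<epsilon> ?k) \<otimes> \<sigma> (ginv G g)"
    using g k by (simp add: \<sigma>_mult_\<epsilon>[OF c] M.m_assoc G.arrow_simps)
  also have "\<dots> = \<epsilon> h \<otimes> \<epsilon> g"
    unfolding \<sigma>_mult_\<epsilon>[OF ck(1)] gk using g h by (simp add: \<epsilon>_def[of g] M.m_assoc G.arrow_simps)
  finally show ?thesis .
qed

text \<open>
  The sense in which \<open>\<sigma>\<close> is partially multiplicative: the defect is the idempotent \<open>\<epsilon> h\<inverse>\<close>.
\<close>

lemma \<sigma>_mult_\<sigma>_mult_\<epsilon>_ginv:
  assumes "(g, h) \<in> composable G"
  shows "\<sigma> g \<otimes> \<sigma> h = \<sigma> (gmult G g h) \<otimes> \<epsilon> (ginv G h)"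
proof -
  have gh: "g \<in> arrows G" "h \<in> arrows G" and k: "gmult G g h \<in> arrows G"
    using assms by (auto simp: composable_iff G.arrow_simps)
  have "\<sigma> g \<otimes> \<sigma> h = \<sigma> g \<otimes> \<sigma> h \<otimes> \<sigma> (ginv G h) \<otimes> \<sigma> h"
    using gh \<sigma>_mult_\<epsilon>_ginv[of h] by (simp add: \<epsilon>_def M.m_assoc G.arrow_simps)
  then show ?thesis
    using gh k by (simp add: \<sigma>_mult_mult_ginv[OF assms] \<epsilon>_def M.m_assoc G.arrow_simps)
qed

text \<open>
  Commuting idempotents \<open>\<epsilon> x\<close> generate a Boolean algebra, whose atoms are the products of factors
  \<open>\<epsilon> x\<close> and \<open>\<one> \<ominus> \<epsilon> x\<close>.  The ambient ring is not commutative, so the product is taken along a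
  list of arrows; \<open>A\<close> prescribes which factors occur uncomplemented.
\<close>

fun atom where
  "atom A [] = \<one>"
| "atom A (x # xs) = (if x \<in> A then \<epsilon> x else \<one> \<ominus> \<epsilon> x) \<otimes> atom A xs"

lemma atom_closed [simp]: "set xs \<subseteq> arrows G \<Longrightarrow> atom A xs \<in> carrier M"
  by (induction xs) auto

lemma atom_cong: "(\<And>x. x \<in> set xs \<Longrightarrow> x \<in> A \<longleftrightarrow> x \<in> B) \<Longrightarrow> atom A xs = atom B xs"
  by (induction xs) simp_all

lemma \<epsilon>_mult_atom:
  assumes "set xs \<subseteq> arrows_into_dm G g" "x \<in> set xs"
  shows "\<epsilon> x \<otimes> atom A xs = (if x \<in> A then atom A xs else \<zero>)"
  using assms
proof (induction xs)
  case (Cons y ys)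
  have x: "x \<in> arrows G" and y: "y \<in> arrows G" and r: "rn G x = rn G y"
    and ys: "set ys \<subseteq> arrows G" "set ys \<subseteq> arrows_into_dm G g"
    using Cons.prems by (auto simp: arrows_into_dm_def)
  define f where "f = (if y \<in> A then \<epsilon> y else \<one> \<ominus> \<epsilon> y)"
  have f: "f \<in> carrier M" using y by (simp add: f_def)
  have at: "atom A ys \<in> carrier M" using ys by simp
  have atom: "atom A (y # ys) = f \<otimes> atom A ys" by (simp add: f_def)
  have \<epsilon>x: "\<epsilon> x \<in> carrier M" using x by simp
  show ?case
  proof (cases "x = y")
    case True
    have "\<epsilon> y \<otimes> f = (if y \<in> A then f else \<zero>)"
      using y \<epsilon>_idem[OF y] by (simp add: f_def M.minus_eq M.r_distr M.r_minus M.r_neg)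
    then have "\<epsilon> x \<otimes> f \<otimes> atom A ys = (if x \<in> A then f \<otimes> atom A ys else \<zero>)"
      using True at by simp
    then show ?thesis unfolding atom by (simp only: M.m_assoc[OF \<epsilon>x f at])
  next
    case False
    have "\<epsilon> x \<otimes> f = f \<otimes> \<epsilon> x"
      using x y \<epsilon>_comm[OF x y r]
      by (simp add: f_def M.minus_eq M.r_distr M.l_distr M.r_minus M.l_minus)
    then have "\<epsilon> x \<otimes> atom A (y # ys) = f \<otimes> (\<epsilon> x \<otimes> atom A ys)"
      unfolding atom using \<epsilon>x f at by (metis M.m_assoc)
    also have "\<dots> = f \<otimes> (if x \<in> A then atom A ys else \<zero>)"
      using Cons False ys by simp
    finally show ?thesis unfolding atom using f by simp
  qed
qed simp

text \<open>
  The expansion of \<open>\<one> = (\<epsilon> x\<^sub>1 \<oplus> (\<one> \<ominus> \<epsilon> x\<^sub>1)) \<otimes> \<dots> \<otimes> (\<epsilon> x\<^sub>n \<oplus> (\<one> \<ominus> \<epsilon> x\<^sub>n))\<close>.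
\<close>

lemma sum_atoms:
  assumes "distinct xs" "set xs \<subseteq> arrows G"
  shows "(\<Oplus>A\<in>Pow (set xs). atom A xs) = \<one>"
  using assms
proof (induction xs)
  case Nil
  then show ?case by simp
next
  case (Cons x xs)
  let ?P = "Pow (set xs)"
  have x: "x \<in> arrows G" "x \<notin> set xs" and xs: "set xs \<subseteq> arrows G" using Cons.prems by auto
  have disj: "?P \<inter> insert x ` ?P = {}" using x by auto
  have inj: "inj_on (insert x) ?P" using x by (auto simp: inj_on_def)
  have c: "atom A (x # xs) \<in> carrier M" for A using x xs by (intro atom_closed) auto
  have "(\<Oplus>A\<in>Pow (set (x # xs)). atom A (x # xs)) =
      (\<Oplus>A\<in>?P. atom A (x # xs)) \<oplus> (\<Oplus>A\<in>insert x ` ?P. atom A (x # xs))"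
    unfolding list.set Pow_insert using c disj by (intro M.finsum_Un_disjoint) auto
  also have "(\<Oplus>A\<in>insert x ` ?P. atom A (x # xs)) = (\<Oplus>A\<in>?P. atom (insert x A) (x # xs))"
    using c inj by (intro M.finsum_reindex) auto
  also have "\<dots> = (\<Oplus>A\<in>?P. \<epsilon> x \<otimes> atom A xs)"
  proof (rule M.finsum_cong')
    fix A
    have "atom (insert x A) xs = atom A xs" using x by (intro atom_cong) auto
    then show "atom (insert x A) (x # xs) = \<epsilon> x \<otimes> atom A xs" by simp
  qed (use x xs in auto)
  also have "\<dots> = \<epsilon> x \<otimes> (\<Oplus>A\<in>?P. atom A xs)"
    using x xs by (intro M.finsum_rdistr[symmetric]) auto
  also have "(\<Oplus>A\<in>?P. atom A (x # xs)) = (\<Oplus>A\<in>?P. (\<one> \<ominus> \<epsilon> x) \<otimes> atom A xs)"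
    using x xs by (intro M.finsum_cong') auto
  also have "\<dots> = (\<one> \<ominus> \<epsilon> x) \<otimes> (\<Oplus>A\<in>?P. atom A xs)"
    using x xs by (intro M.finsum_rdistr[symmetric]) auto
  finally show ?case
    using Cons x xs by (simp add: M.minus_eq M.a_assoc M.l_neg)
qed

text \<open>
  The element that corresponds to the basis vector \<open>(A, g)\<close> of the groupoid algebra of the
  expansion.  The enumeration depends on \<open>g\<close> only through \<open>arrows_into_dm G g\<close>, so arrows with
  the same domain share their atoms.
\<close>

definition \<tau> where
  "\<tau> = (\<lambda>(A, g). \<sigma> g \<otimes> atom A (SOME xs. set xs = arrows_into_dm G g \<and> distinct xs))"

context
  assumes finite_arrows: "finite (arrows G)"
begin

lemma enumerate_arrows_into_dm:
  obtains xs where "set xs = arrows_into_dm G g" "distinct xs"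
    "\<And>A h. arrows_into_dm G h = arrows_into_dm G g \<Longrightarrow> \<tau> (A, h) = \<sigma> h \<otimes> atom A xs"
proof -
  let ?xs = "SOME xs. set xs = arrows_into_dm G g \<and> distinct xs"
  have "finite (arrows_into_dm G g)"
    by (rule finite_subset[OF _ finite_arrows]) (auto simp: arrows_into_dm_def)
  then have "\<exists>xs. set xs = arrows_into_dm G g \<and> distinct xs" by (rule finite_distinct_list)
  then have "set ?xs = arrows_into_dm G g \<and> distinct ?xs" by (rule someI_ex)
  then show ?thesis by (intro that[of ?xs]) (auto simp: \<tau>_def)
qed

lemma \<tau>_closed: "g \<in> arrows G \<Longrightarrow> \<tau> (A, g) \<in> carrier M"
proof -
  assume g: "g \<in> arrows G"
  obtain xs where "set xs = arrows_into_dm G g" "\<tau> (A, g) = \<sigma> g \<otimes> atom A xs"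
    using enumerate_arrows_into_dm[of g] by metis
  then show ?thesis using g by (auto simp: arrows_into_dm_def)
qed

text \<open>
  The conditions \<open>dm G g \<in> A\<close> and \<open>ginv G g \<in> A\<close> on the arrows of the expansion are forced:
  \<open>\<sigma> g\<close> absorbs \<open>\<epsilon> (dm G g)\<close> and \<open>\<epsilon> (ginv G g)\<close> on the right, and the atom of \<open>A\<close> is killed by
  \<open>\<epsilon> x\<close> for every \<open>x\<close> outside \<open>A\<close> that ends at \<open>dm G g\<close>.
\<close>

lemma \<tau>_eq_zero:
  assumes g: "g \<in> arrows G" and nA: "\<not> (dm G g \<in> A \<and> ginv G g \<in> A)"
  shows "\<tau> (A, g) = \<zero>"
proof -
  obtain xs where xs: "set xs = arrows_into_dm G g" "\<tau> (A, g) = \<sigma> g \<otimes> atom A xs"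
    using enumerate_arrows_into_dm[of g] by metis
  have sub: "set xs \<subseteq> arrows G" using xs by (auto simp: arrows_into_dm_def)
  have *: "\<tau> (A, g) = \<zero>" if x: "x \<in> arrows_into_dm G g" "x \<notin> A" and fix_x: "\<sigma> g \<otimes> \<epsilon> x = \<sigma> g" for x
  proof -
    have "\<tau> (A, g) = \<sigma> g \<otimes> (\<epsilon> x \<otimes> atom A xs)"
      using xs sub g x fix_x by (simp add: arrows_into_dm_def flip: M.m_assoc)
    then show ?thesis using \<epsilon>_mult_atom[of xs g x A] xs x g by simp
  qed
  show ?thesis
  proof (cases "dm G g \<in> A")
    case True
    then show ?thesis
      using nA g
        by (intro *[of "ginv G g"]) (simp_all add: arrows_into_dm_def G.arrow_simps \<sigma>_mult_\<epsilon>_ginv)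
  next
    case False
    have "\<epsilon> (dm G g) = \<sigma> (dm G g)"
      using \<sigma>_dm[of "dm G g"] g by (simp add: \<epsilon>_def G.arrow_simps)
    then show ?thesis
      using False g by (intro *[of "dm G g"]) (simp_all add: arrows_into_dm_def G.arrow_simps \<sigma>_dm)
  qed
qed

text \<open>
  The multiplication rule that makes \<open>\<tau>\<close> compatible with the expansion: the factor \<open>\<epsilon> g\<inverse>\<close> is
  the only obstacle to \<open>\<sigma> h \<otimes> \<sigma> g = \<sigma> (h g)\<close>, and the atom of \<open>A\<close> absorbs it because \<open>ginv G g \<in> A\<close>.
\<close>

lemma \<sigma>_mult_\<tau>:
  assumes h: "h \<in> arrows G" and Ag: "(A, g) \<in> arrows (birget_rhodes G)"
  shows "\<sigma> h \<otimes> \<tau> (A, g) =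
    (if dm G h = rn G g \<and> (A, gmult G h g) \<in> arrows (birget_rhodes G)
     then \<tau> (A, gmult G h g) else \<zero>)"
proof -
  obtain xs where xs: "set xs = arrows_into_dm G g"
    "\<And>A h. arrows_into_dm G h = arrows_into_dm G g \<Longrightarrow> \<tau> (A, h) = \<sigma> h \<otimes> atom A xs"
    using enumerate_arrows_into_dm[of g] by metis
  have g: "g \<in> arrows G" "ginv G g \<in> A" "A \<subseteq> arrows_into_dm G g" "dm G g \<in> A"
    using Ag by (auto simp: arrow_birget_rhodes_iff)
  have at: "atom A xs \<in> carrier M" using xs by (auto simp: arrows_into_dm_def)
  show ?thesis
  proof (cases "dm G h = rn G g")
    case False
    then have "\<sigma> h \<otimes> \<sigma> g = \<zero>" using h g by (intro \<sigma>_zero) (auto simp: composable_iff)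
    then show ?thesis using False xs(2)[of g A] h g at by (simp flip: M.m_assoc)
  next
    case True
    then have c: "(h, g) \<in> composable G" using h g by (simp add: composable_iff)
    let ?k = "gmult G h g"
    have k: "?k \<in> arrows G" "dm G ?k = dm G g" "arrows_into_dm G ?k = arrows_into_dm G g"
      using c by (simp_all add: G.arrow_simps G.arrows_into_dm_gmult)
    have "\<epsilon> (ginv G g) \<otimes> atom A xs = atom A xs"
      using g xs by (subst \<epsilon>_mult_atom[of _ g]) auto
    then have "\<sigma> h \<otimes> \<tau> (A, g) = \<sigma> ?k \<otimes> atom A xs"
      using h g k at \<sigma>_mult_\<sigma>_mult_\<epsilon>_ginv[OF c] xs(2)[of g A]
      by (simp add: M.m_assoc G.arrow_simps flip: M.m_assoc[of "\<sigma> h"])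
    also have "\<dots> = \<tau> (A, ?k)" using xs(2)[OF k(3)] by simp
    finally show ?thesis
      using True k g \<tau>_eq_zero[OF k(1), of A] by (auto simp: arrow_birget_rhodes_iff)
  qed
qed

text \<open>
  Multiplying the partition of unity into atoms by \<open>\<sigma> g\<close> leaves exactly the terms that belong to
  arrows of the expansion, by \<open>\<tau>_eq_zero\<close>.
\<close>

lemma sum_\<tau>:
  assumes g: "g \<in> arrows G"
  shows "(\<Oplus>x\<in>{x \<in> arrows (birget_rhodes G). snd x = g}. \<tau> x) = \<sigma> g"
proof -
  obtain xs where xs: "set xs = arrows_into_dm G g" "distinct xs" "\<And>A. \<tau> (A, g) = \<sigma> g \<otimes> atom A xs"
    using enumerate_arrows_into_dm[of g] by metis
  let ?P = "{A. (A, g) \<in> arrows (birget_rhodes G)}"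
  have sub: "set xs \<subseteq> arrows G" using xs by (auto simp: arrows_into_dm_def)
  have fin: "finite (Pow (arrows_into_dm G g))" using xs(1)
    by (metis List.finite_set finite_Pow_iff)
  have "{x \<in> arrows (birget_rhodes G). snd x = g} = (\<lambda>A. (A, g)) ` ?P" by auto
  then have "(\<Oplus>x\<in>{x \<in> arrows (birget_rhodes G). snd x = g}. \<tau> x) = (\<Oplus>A\<in>?P. \<tau> (A, g))"
    using \<tau>_closed[OF g] by (simp only:, intro M.finsum_reindex) (auto simp: inj_on_def)
  also have "\<dots> = (\<Oplus>A\<in>Pow (arrows_into_dm G g). \<tau> (A, g))"
    using \<tau>_closed[OF g] \<tau>_eq_zero[OF g] g
    by (intro M.finsum_neutral_sub[OF fin]) (auto simp: arrow_birget_rhodes_iff)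
  also have "\<dots> = (\<Oplus>A\<in>Pow (set xs). \<sigma> g \<otimes> atom A xs)"
    using xs by simp
  also have "\<dots> = \<sigma> g \<otimes> (\<Oplus>A\<in>Pow (set xs). atom A xs)"
    using sub g by (intro M.finsum_rdistr[symmetric]) auto
  finally show ?thesis using sum_atoms[OF xs(2) sub] g by simp
qed

end

end

section \<open>The groupoid algebra of the expansion\<close>

locale birget_rhodes_algebra = K: field K + G: groupoid G for K (structure) and G +
  assumes finite_arrows: "finite (arrows G)"
begin

abbreviation "E \<equiv> birget_rhodes G"
abbreviation "B \<equiv> groupoid_algebra K E"

lemma finite_arrows_expansion: "finite (arrows E)"
proof (rule finite_subset)
  show "arrows E \<subseteq> Pow (arrows G) \<times> arrows G"
    by (auto simp: birget_rhodes_def arrows_into_dm_def)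
qed (simp add: finite_arrows)

sublocale basis: partial_semigroup_basis K "arrows E"
  "\<lambda>x y. if dm E x = rn E y then Some (gmult E x y) else None" "objects E"
  using K.is_cring G.birget_rhodes_groupoid finite_arrows_expansion
  by (rule partial_semigroup_basis_groupoid)

lemma B_eq: "B = basis.BA"
  by (simp add: groupoid_algebra_def)

lemma assoc_algebra_B: "assoc_algebra K B"
  unfolding B_eq by (rule basis.assoc_algebra_BA)

lemma expansion_simps:
  "dm E (A, g) = (A, dm G g)" "rn E (A, g) = (gmult G g ` A, rn G g)"
  "gmult E (A, g) (D, h) = (D, gmult G g h)"
  by (simp_all add: birget_rhodes_def)

text \<open>
  Left multiplication of \<open>(A, g)\<close> by some arrow over \<open>h\<close> is possible iff \<open>(A, h g)\<close> is an arrow of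
  the expansion, because \<open>ginv G h = g \<cdot> ginv G (h \<cdot> g)\<close>; the left factor can only be \<open>(g A, h)\<close>.
\<close>

lemma arrow_expansion_gmult_iff:
  assumes Ag: "(A, g) \<in> arrows E" and hg: "(h, g) \<in> composable G"
  shows "(gmult G g ` A, h) \<in> arrows E \<longleftrightarrow> (A, gmult G h g) \<in> arrows E"
proof -
  have g: "g \<in> arrows G" "A \<subseteq> arrows_into_dm G g" "dm G g \<in> A" "ginv G g \<in> A"
    and h: "h \<in> arrows G" "dm G h = rn G g"
    using Ag hg by (auto simp: arrow_birget_rhodes_iff composable_def)
  have "gmult G g ` A \<subseteq> arrows_into_dm G h"
    using g h by (auto simp: arrows_into_dm_def composable_def G.arrow_simps subset_iff)
  moreover have "dm G h \<in> gmult G g ` A"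
    using g h by (metis G.gmult_ginv imageI)
  moreover have "ginv G h \<in> gmult G g ` A \<longleftrightarrow> ginv G (gmult G h g) \<in> A"
  proof -
    have k: "ginv G (gmult G h g) = gmult G (ginv G g) (ginv G h)" by (rule G.ginv_mult[OF hg])
    have 1: "gmult G g (gmult G (ginv G g) (ginv G h)) = ginv G h"
      using g h by (intro G.gmult_ginv_gmult) (simp_all add: G.arrow_simps)
    have "gmult G (ginv G g) (gmult G g a) = a" if "a \<in> A" for a
      using that g by (intro G.ginv_gmult_gmult) (auto simp: composable_def arrows_into_dm_def)
    then show ?thesis unfolding k using 1 by (metis (no_types, lifting) imageE imageI)
  qed
  ultimately show ?thesis
    using g h hg by (simp add: arrow_birget_rhodes_iff G.arrow_simps G.arrows_into_dm_gmult)
qed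

text \<open>
  The element of \<open>B\<close> that stands for the generator \<open>[g]\<close>.
\<close>

definition arrow_sum :: "'c \<Rightarrow> 'c set \<times> 'c \<Rightarrow> 'a" where
  "arrow_sum g = (\<lambda>x. if x \<in> arrows E \<and> snd x = g then \<one> else \<zero>)"

lemma supp_arrow_sum: "supp K (arrow_sum g) \<subseteq> {x \<in> arrows E. snd x = g}"
  by (auto simp: supp_def arrow_sum_def)

lemma arrow_sum_closed: "arrow_sum g \<in> carrier B"
  unfolding B_eq basis.BA_carrier
  using supp_arrow_sum[of g] finite_subset[OF supp_arrow_sum] finite_arrows_expansion
  by (auto simp: arrow_sum_def)

text \<open>
  At most one term of the double sum survives: \<open>(A, k)\<close> is a product with left factor over \<open>h\<close>
  only as \<open>(g A, h) \<cdot> (A, g)\<close> with \<open>g = h\<inverse> k\<close>.  With this formula, identities between products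
  of arrow sums become conditions on a single arrow.
\<close>

lemma arrow_sum_mult:
  assumes h: "h \<in> arrows G" and f: "f \<in> carrier B"
  shows "(arrow_sum h \<otimes>\<^bsub>B\<^esub> f) (A, k) =
    (if (A, k) \<in> arrows E \<and> rn G k = rn G h then f (A, gmult G (ginv G h) k) else \<zero>)"
proof -
  let ?Y = "{x \<in> arrows E. snd x = h}" and ?Z = "arrows E" and ?g = "gmult G (ginv G h) k"
  let ?p = "\<lambda>x y. if dm E x = rn E y then Some (gmult E x y) else None"
  have fB: "f \<in> carrier basis.BA" using f unfolding B_eq .
  have fK: "f x \<in> carrier K" for x using fB unfolding basis.BA_carrier by blast
  have f0: "f x = \<zero>" if "x \<notin> arrows E" for x
    using fB that unfolding basis.BA_carrier supp_def by blast
  have aK: "arrow_sum h x \<in> carrier K" for x by (simp add: arrow_sum_def)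
  have fin: "finite ?Y" "finite ?Z" using finite_arrows_expansion by auto
  have "(arrow_sum h \<otimes>\<^bsub>B\<^esub> f) (A, k) =
      (\<Oplus>y\<in>?Y. \<Oplus>z\<in>?Z. if ?p y z = Some (A, k) then arrow_sum h y \<otimes> f z else \<zero>)"
    unfolding B_eq
    using fB arrow_sum_closed fin supp_arrow_sum
    by (intro basis.BA_mult) (simp_all add: B_eq basis.BA_carrier)
  also have "\<dots> = (\<Oplus>z\<in>?Z. \<Oplus>y\<in>?Y. if ?p y z = Some (A, k) then arrow_sum h y \<otimes> f z else \<zero>)"
    by (rule K.finsum_swap[OF fin]) (simp add: fK aK)
  also have "\<dots> = (\<Oplus>z\<in>?Z. if z = (A, ?g) then
      (if (A, k) \<in> arrows E \<and> rn G k = rn G h then f z else \<zero>) else \<zero>)"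
  proof (rule K.finsum_cong'[OF refl])
    fix z assume z: "z \<in> ?Z"
    obtain D g where Dg: "z = (D, g)" by fastforce
    have g: "g \<in> arrows G" using z Dg by (simp add: arrow_birget_rhodes_iff)
    let ?y = "(gmult G g ` D, h)"
    have "(\<Oplus>y\<in>?Y. if ?p y z = Some (A, k) then arrow_sum h y \<otimes> f z else \<zero>) =
        (\<Oplus>y\<in>?Y. if y = ?y then (if dm G h = rn G g \<and> D = A \<and> gmult G h g = k then f z else \<zero>)
          else \<zero>)"
    proof (rule K.finsum_cong'[OF refl])
      fix y assume y: "y \<in> ?Y"
      obtain C where C: "y = (C, h)" using y by (cases y) simp
      show "(if ?p y z = Some (A, k) then arrow_sum h y \<otimes> f z else \<zero>) =
          (if y = ?y then (if dm G h = rn G g \<and> D = A \<and> gmult G h g = k then f z else \<zero>) else \<zero>)"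
        using y by (auto simp: C Dg expansion_simps arrow_sum_def fK)
    qed (simp add: fK)
    also have "\<dots> = (if ?y \<in> ?Y then (if dm G h = rn G g \<and> D = A \<and> gmult G h g = k then f z else \<zero>)
      else \<zero>)"
      by (rule K.finsum_delta) (simp_all add: fin fK)
    also have "\<dots> = (if dm G h = rn G g \<and> D = A \<and> gmult G h g = k \<and> (A, k) \<in> arrows E then f z
      else \<zero>)"
    proof (cases "dm G h = rn G g")
      case True
      then have "(h, g) \<in> composable G" using g h by (simp add: composable_def)
      from arrow_expansion_gmult_iff[OF z[unfolded Dg] this] show ?thesis by auto
    qed simp
    also have "\<dots> = (if z = (A, ?g) then
        (if (A, k) \<in> arrows E \<and> rn G k = rn G h then f z else \<zero>) else \<zero>)"
    proof -
      have "dm G h = rn G g \<and> gmult G h g = k \<longleftrightarrow> g = ?g \<and> rn G k = rn G h" if "k \<in> arrows G"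
      proof
        assume l: "dm G h = rn G g \<and> gmult G h g = k"
        then have "(h, g) \<in> composable G" using g h by (simp add: composable_def)
        then show "g = ?g \<and> rn G k = rn G h"
          using l G.ginv_gmult_gmult[of h g] G.rn_gmult[of h g] by simp
      next
        assume r: "g = ?g \<and> rn G k = rn G h"
        then have "(ginv G h, k) \<in> composable G" using h that
          by (simp add: composable_def G.arrow_simps)
        then show "dm G h = rn G g \<and> gmult G h g = k"
          using r h that G.rn_gmult[of "ginv G h" k] G.gmult_ginv_gmult[of h k]
            by (simp add: G.arrow_simps)
      qed
      moreover have "(A, k) \<in> arrows E \<Longrightarrow> k \<in> arrows G" by (simp add: arrow_birget_rhodes_iff)
      ultimately show ?thesis unfolding Dg by auto
    qed
    finally show "(\<Oplus>y\<in>?Y. if ?p y z = Some (A, k) then arrow_sum h y \<otimes> f z else \<zero>) = \<dots>" .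
  qed (simp add: fK)
  also have "\<dots> = (if (A, ?g) \<in> ?Z then
      (if (A, k) \<in> arrows E \<and> rn G k = rn G h then f (A, ?g) else \<zero>) else \<zero>)"
    by (rule K.finsum_delta) (simp_all add: fin fK)
  finally show ?thesis using f0 by auto
qed

lemma arrow_expansion_simps:
  assumes "(A, g) \<in> arrows E"
  shows "g \<in> arrows G" "A \<subseteq> arrows_into_dm G g" "dm G g \<in> A" "ginv G g \<in> A"
  using assms by (auto simp: arrow_birget_rhodes_iff)

lemma fun_pair_ext:
  assumes "\<And>A k. f (A, k) = g (A, k)" shows "f = g"
  using assms by (auto simp: fun_eq_iff)

lemma B_apply:
  "\<zero>\<^bsub>B\<^esub> x = \<zero>" "(f \<oplus>\<^bsub>B\<^esub> g) x = f x \<oplus> g x" "(c \<odot>\<^bsub>B\<^esub> f) x = c \<otimes> f x"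
  "\<one>\<^bsub>B\<^esub> x = (if x \<in> objects E then \<one> else \<zero>)"
  by (simp_all add: B_eq basis.BA_simps)

lemma arrow_sum_mult_basis_vector:
  assumes h: "h \<in> arrows G" and Ag: "(A, g) \<in> arrows E"
  shows "arrow_sum h \<otimes>\<^bsub>B\<^esub> basis_vector K (A, g) =
    (if dm G h = rn G g \<and> (A, gmult G h g) \<in> arrows E
     then basis_vector K (A, gmult G h g) else \<zero>\<^bsub>B\<^esub>)"
proof (rule fun_pair_ext)
  fix D k
  have g: "g \<in> arrows G" using arrow_expansion_simps[OF Ag] by simp
  have bv: "basis_vector K (A, g) \<in> carrier B" using basis.basis_vector_in_carrier[OF Ag]
    by (simp add: B_eq)
  have "rn G k = rn G h \<and> gmult G (ginv G h) k = g \<longleftrightarrow> dm G h = rn G g \<and> k = gmult G h g"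
    if "k \<in> arrows G"
    using G.ginv_gmult_gmult[of h g] G.gmult_ginv_gmult[of h k]
      G.rn_gmult[of h g] G.rn_gmult[of "ginv G h" k] g h that
    by (auto simp: composable_def G.arrow_simps)
  moreover have "(D, k) \<in> arrows E \<Longrightarrow> k \<in> arrows G" by (simp add: arrow_birget_rhodes_iff)
  ultimately show "(arrow_sum h \<otimes>\<^bsub>B\<^esub> basis_vector K (A, g)) (D, k) =
    (if dm G h = rn G g \<and> (A, gmult G h g) \<in> arrows E
     then basis_vector K (A, gmult G h g) else \<zero>\<^bsub>B\<^esub>) (D, k)"
    unfolding arrow_sum_mult[OF h bv] by (auto simp: basis_vector_def B_apply)
qed

text \<open>
  A product of arrow sums is the indicator function of the \<open>(A, k)\<close> for which \<open>k\<close> is the product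
  in \<open>G\<close> and \<open>A\<close> contains the inverses of all its right-hand partial products.  In the first two
  relations the two sides require the same inverses.
\<close>

lemma partial_representation_arrow_sum: "partial_representation G B arrow_sum"
proof -
  interpret B: assoc_algebra K B by (rule assoc_algebra_B)
  note sc = arrow_sum_closed B.M.m_closed
  have prod: "(arrow_sum g \<otimes>\<^bsub>B\<^esub> arrow_sum h) (A, k) =
      (if (A, k) \<in> arrows E \<and> dm G g = rn G h \<and> k = gmult G g h \<and> ginv G h \<in> A then \<one> else \<zero>)"
    if g: "g \<in> arrows G" and h: "h \<in> arrows G" for g h A k
  proof -
    have "(A, k) \<in> arrows E \<and> rn G k = rn G g \<and> (A, gmult G (ginv G g) k) \<in> arrows E \<and> gmult G (ginv G g) k = h
      \<longleftrightarrow> (A, k) \<in> arrows E \<and> dm G g = rn G h \<and> k = gmult G g h \<and> ginv G h \<in> A" (is "?l \<longleftrightarrow> ?r")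
    proof
      assume ?l
      then show ?r using g h G.gmult_ginv_gmult[of g k] G.rn_gmult[of "ginv G g" k]
        by (auto simp: arrow_birget_rhodes_iff composable_iff G.arrow_simps)
    next
      assume ?r
      then show ?l using g h G.ginv_gmult_gmult[of g h]
        by (auto simp: arrow_birget_rhodes_iff composable_iff G.arrow_simps G.arrows_into_dm_gmult)
    qed
    then show ?thesis unfolding arrow_sum_mult[OF g arrow_sum_closed]
      by (auto simp: arrow_sum_def)
  qed
  show ?thesis
  proof unfold_locales
    fix g h assume gh: "(g, h) \<in> composable G"
    then have g: "g \<in> arrows G" and h: "h \<in> arrows G" and d: "dm G g = rn G h"
      by (auto simp: composable_iff)
    have k: "gmult G g h \<in> arrows G" "dm G (gmult G g h) = dm G h" "rn G (gmult G g h) = rn G g"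
      "ginv G (gmult G g h) = gmult G (ginv G h) (ginv G g)"
      using gh by (simp_all add: G.arrow_simps G.ginv_mult)
    have i: "ginv G g \<in> arrows G" "ginv G h \<in> arrows G" using g h by (simp_all add: G.arrow_simps)
    show "arrow_sum (ginv G g) \<otimes>\<^bsub>B\<^esub> arrow_sum g \<otimes>\<^bsub>B\<^esub> arrow_sum h =
        arrow_sum (ginv G g) \<otimes>\<^bsub>B\<^esub> arrow_sum (gmult G g h)"
    proof (rule fun_pair_ext)
      fix A k
      have "ginv G h \<in> A" if "(A, k) \<in> arrows E" "rn G k = dm G g" "gmult G g k = gmult G g h"
      proof -
        have "(g, k) \<in> composable G"
          using that(2) g arrow_expansion_simps(1)[OF that(1)] by (simp add: composable_iff)
        then have "k = h" using G.ginv_gmult_gmult gh that(3) by metis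
        then show ?thesis using arrow_expansion_simps(4)[OF that(1)] by simp
      qed
      then show "(arrow_sum (ginv G g) \<otimes>\<^bsub>B\<^esub> arrow_sum g \<otimes>\<^bsub>B\<^esub> arrow_sum h) (A, k) =
        (arrow_sum (ginv G g) \<otimes>\<^bsub>B\<^esub> arrow_sum (gmult G g h)) (A, k)"
        unfolding B.M.m_assoc[OF sc(1) sc(1) sc(1)] arrow_sum_mult[OF i(1) sc(2)[OF sc(1) sc(1)]]
          arrow_sum_mult[OF i(1) sc(1)] prod[OF g h] G.rn_ginv[OF g] G.ginv_ginv[OF g]
        using d by (simp add: arrow_sum_def) metis
    qed
    show "arrow_sum g \<otimes>\<^bsub>B\<^esub> arrow_sum h \<otimes>\<^bsub>B\<^esub> arrow_sum (ginv G h) =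
        arrow_sum (gmult G g h) \<otimes>\<^bsub>B\<^esub> arrow_sum (ginv G h)"
    proof (rule fun_pair_ext)
      fix A k
      have ghh: "gmult G (gmult G g h) (ginv G h) = g"
        using gh G.gmult_assoc[OF gh, of "ginv G h"] g h d G.right_id[OF g]
          by (simp add: composable_iff G.arrow_simps)
      have "rn G k = rn G g \<and> (A, gmult G (ginv G g) k) \<in> arrows E \<and> gmult G (ginv G g) k = rn G h
        \<longleftrightarrow> k = g"
        if Ak: "(A, k) \<in> arrows E"
      proof
        assume "rn G k = rn G g \<and> (A, gmult G (ginv G g) k) \<in> arrows E \<and> gmult G (ginv G g) k = rn G h"
        then show "k = g"
          using G.gmult_ginv_gmult[OF g, of k] G.right_id[OF g] d arrow_expansion_simps(1)[OF Ak] by simp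
      next
        assume kg: "k = g"
        have "(A, dm G g) \<in> arrows E"
          using arrow_expansion_simps[OF Ak] g unfolding kg
          by (simp add: arrow_birget_rhodes_iff G.arrow_simps arrows_into_dm_def)
        then show "rn G k = rn G g \<and> (A, gmult G (ginv G g) k) \<in> arrows E \<and> gmult G (ginv G g) k = rn G h"
          using kg g d by (simp add: G.arrow_simps)
      qed
      then show "(arrow_sum g \<otimes>\<^bsub>B\<^esub> arrow_sum h \<otimes>\<^bsub>B\<^esub> arrow_sum (ginv G h)) (A, k) =
        (arrow_sum (gmult G g h) \<otimes>\<^bsub>B\<^esub> arrow_sum (ginv G h)) (A, k)"
        unfolding B.M.m_assoc[OF sc(1) sc(1) sc(1)] arrow_sum_mult[OF g sc(2)[OF sc(1) sc(1)]]
          prod[OF h i(2)] prod[OF k(1) i(2)] ghh k(2) G.rn_ginv[OF h] G.gmult_ginv[OF h]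
        by (simp cong: conj_cong) metis
    qed
  next
    fix g assume g: "g \<in> arrows G"
    have ids: "rn G g \<in> arrows G" "dm G g \<in> arrows G" using g by (simp_all add: G.arrow_simps)
    show "arrow_sum (rn G g) \<otimes>\<^bsub>B\<^esub> arrow_sum g = arrow_sum g"
      by (rule fun_pair_ext; unfold prod[OF ids(1) g])
        (use g arrow_expansion_simps(4) in \<open>auto simp: G.arrow_simps arrow_sum_def\<close>)
    show "arrow_sum g \<otimes>\<^bsub>B\<^esub> arrow_sum (dm G g) = arrow_sum g"
      by (rule fun_pair_ext; unfold prod[OF g ids(2)])
        (use g arrow_expansion_simps(3) in \<open>auto simp: G.arrow_simps arrow_sum_def\<close>)
  next
    fix g h assume "g \<in> arrows G" "h \<in> arrows G" "(g, h) \<notin> composable G"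
    then show "arrow_sum g \<otimes>\<^bsub>B\<^esub> arrow_sum h = \<zero>\<^bsub>B\<^esub>"
      by (intro fun_pair_ext) (auto simp: prod composable_iff B_apply)
  qed (rule arrow_sum_closed)
qed

lemma sum_arrow_sum_objects: "(\<Oplus>\<^bsub>B\<^esub>e\<in>objects G. arrow_sum e) = \<one>\<^bsub>B\<^esub>"
proof (rule fun_pair_ext)
  fix A k
  interpret B: assoc_algebra K B by (rule assoc_algebra_B)
  have fin: "finite (objects G)" using finite_arrows by (simp add: objects_def)
  have "(\<Oplus>\<^bsub>B\<^esub>e\<in>I. arrow_sum e) (A, k) = (\<Oplus>e\<in>I. arrow_sum e (A, k))" if "finite I" for I
    using that
  proof (induction I)
    case empty
    then show ?case by (simp add: B_apply)
  next
    case (insert e I)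
    have "arrow_sum e (A, k) \<in> carrier K" for e by (simp add: arrow_sum_def)
    then show ?case
      using insert arrow_sum_closed by (simp add: Pi_def B_apply)
  qed
  also have "(\<Oplus>e\<in>objects G. arrow_sum e (A, k)) =
      (\<Oplus>e\<in>objects G. if e = k then (if (A, k) \<in> arrows E then \<one> else \<zero>) else \<zero>)"
    by (rule K.finsum_cong') (auto simp: arrow_sum_def)
  also have "\<dots> = (if k \<in> objects G then (if (A, k) \<in> arrows E then \<one> else \<zero>) else \<zero>)"
    using fin by (intro K.finsum_delta) simp_all
  also have "\<dots> = \<one>\<^bsub>B\<^esub> (A, k)"
    by (auto simp: B_apply objects_def expansion_simps arrow_birget_rhodes_iff)
  finally show "(\<Oplus>\<^bsub>B\<^esub>e\<in>objects G. arrow_sum e) (A, k) = \<one>\<^bsub>B\<^esub> (A, k)" using fin by simp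
qed

text \<open>
  Let \<open>x\<close> end at \<open>e\<close>.  Multiplication by \<open>arrow_sum x \<otimes> arrow_sum x\<inverse>\<close> restricts a combination
  of the identities \<open>(A, e)\<close> to those with \<open>x \<in> A\<close>, and subtracting the result restricts it to
  those with \<open>x \<notin> A\<close>.
  Restricting in this way for all \<open>x\<close> that end at \<open>e\<close> isolates one identity \<open>(A, e)\<close>, and
  \<open>arrow_sum g \<otimes> (A, dm g) = (A, g)\<close>.
\<close>

lemma arrow_sums_generate:
  assumes J: "J \<subseteq> carrier B"
    and zero: "\<zero>\<^bsub>B\<^esub> \<in> J"
    and sums: "\<And>g. g \<in> arrows G \<Longrightarrow> arrow_sum g \<in> J"
    and add: "\<And>x y. x \<in> J \<Longrightarrow> y \<in> J \<Longrightarrow> x \<oplus>\<^bsub>B\<^esub> y \<in> J"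
    and smult: "\<And>c x. c \<in> carrier K \<Longrightarrow> x \<in> J \<Longrightarrow> c \<odot>\<^bsub>B\<^esub> x \<in> J"
    and mult: "\<And>g x. g \<in> arrows G \<Longrightarrow> x \<in> J \<Longrightarrow> arrow_sum g \<otimes>\<^bsub>B\<^esub> x \<in> J"
  shows "carrier B \<subseteq> J"
proof -
  interpret B: assoc_algebra K B by (rule assoc_algebra_B)
  \<comment> \<open>The sum of the identities \<open>(A, e)\<close> with \<open>X \<subseteq> A\<close> and \<open>A\<close> disjoint from \<open>Y\<close>.\<close>
  define u where "u e X Y = (\<lambda>(A, k). if (A, k) \<in> arrows E \<and> k = e \<and> X \<subseteq> A \<and> A \<inter> Y = {} then \<one>
    else \<zero>)"
    for e X Y
  have meet: "u e X {} \<in> J" if e: "e \<in> objects G" and X: "finite X" "X \<subseteq> arrows_into_dm G e" for e X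
    using X
  proof (induction X)
    case empty
    have "u e {} {} = arrow_sum e" by (rule fun_pair_ext) (simp add: u_def arrow_sum_def)
    then show ?case using sums e by (simp add: G.object_simps)
  next
    case (insert x X)
    note e' = G.object_simps[OF e]
    have uJ: "u e X {} \<in> J" using insert by simp
    then have uB: "u e X {} \<in> carrier B" using J by auto
    have x: "x \<in> arrows G" "rn G x = e" using insert e' by (auto simp: arrows_into_dm_def)
    have x': "ginv G x \<in> arrows G" using x by (simp add: G.arrow_simps)
    have "arrow_sum x \<otimes>\<^bsub>B\<^esub> (arrow_sum (ginv G x) \<otimes>\<^bsub>B\<^esub> u e X {}) = u e (insert x X) {}"
    proof (rule fun_pair_ext)
      fix A k
      have k_back: "gmult G x (gmult G (ginv G x) k) = k" if "(A, k) \<in> arrows E" "rn G k = e"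
        using x that arrow_expansion_simps(1)[OF that(1)] by (intro G.gmult_ginv_gmult) simp_all
      have "(A, gmult G (ginv G x) e) \<in> arrows E \<longleftrightarrow> x \<in> A" if "(A, e) \<in> arrows E"
      proof -
        have "gmult G (ginv G x) e = ginv G x"
          using G.right_id[OF x'] x by (simp add: G.arrow_simps)
        then show ?thesis
          using arrow_expansion_simps[OF that] x e'
          by (auto simp: arrow_birget_rhodes_iff G.arrow_simps arrows_into_dm_def)
      qed
      moreover have "rn G (gmult G (ginv G x) e) = rn G (ginv G x)"
        using x e' by (simp add: G.arrow_simps composable_def)
      ultimately show "(arrow_sum x \<otimes>\<^bsub>B\<^esub> (arrow_sum (ginv G x) \<otimes>\<^bsub>B\<^esub> u e X {})) (A, k) =
          u e (insert x X) {} (A, k)"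
        unfolding arrow_sum_mult[OF x(1) B.M.m_closed[OF arrow_sum_closed uB]]
          arrow_sum_mult[OF x' uB] G.ginv_ginv[OF x(1)]
        using k_back e' x by (auto simp: u_def)
    qed
    then show ?case using mult[OF x(1) mult[OF x' uJ]] by simp
  qed
  have atom: "u e X Y \<in> J"
    if e: "e \<in> objects G" and X: "finite X" "X \<subseteq> arrows_into_dm G e"
      and Y: "finite Y" "Y \<subseteq> arrows_into_dm G e" for e X Y
    using Y X
  proof (induction Y arbitrary: X)
    case empty
    then show ?case using meet e by simp
  next
    case (insert y Y)
    have "u e X (insert y Y) = u e X Y \<oplus>\<^bsub>B\<^esub> (\<ominus> \<one>) \<odot>\<^bsub>B\<^esub> u e (insert y X) Y"
      by (rule fun_pair_ext) (auto simp: u_def B_apply K.r_neg)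
    moreover have "u e X Y \<in> J" "u e (insert y X) Y \<in> J" using insert by simp_all
    ultimately show ?case using add smult by simp
  qed
  have basis_J: "basis_vector K (A, g) \<in> J" if Ag: "(A, g) \<in> arrows E" for A g
  proof -
    note g = arrow_expansion_simps[OF Ag]
    let ?e = "dm G g"
    have e: "?e \<in> objects G" using g by (simp add: objects_def G.arrow_simps)
    have into: "arrows_into_dm G ?e = arrows_into_dm G g" using g
      by (simp add: arrows_into_dm_def G.arrow_simps)
    have fin: "finite (arrows_into_dm G g)"
      by (rule finite_subset[OF _ finite_arrows]) (auto simp: arrows_into_dm_def)
    have Ae: "(A, ?e) \<in> arrows E" using g into by (simp add: arrow_birget_rhodes_iff G.arrow_simps)
    have "u ?e A (arrows_into_dm G g - A) = basis_vector K (A, ?e)"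
    proof (rule fun_pair_ext)
      fix D k
      have "D = A" if "(D, ?e) \<in> arrows E" "A \<subseteq> D" "D \<inter> (arrows_into_dm G g - A) = {}"
        using that arrow_expansion_simps(2)[OF that(1)] into by blast
      then show "u ?e A (arrows_into_dm G g - A) (D, k) = basis_vector K (A, ?e) (D, k)"
        using Ae by (auto simp: u_def basis_vector_def)
    qed
    moreover have "u ?e A (arrows_into_dm G g - A) \<in> J"
      using e g fin into by (intro atom) (auto intro: finite_subset)
    ultimately have "arrow_sum g \<otimes>\<^bsub>B\<^esub> basis_vector K (A, ?e) \<in> J" using mult g by simp
    then show ?thesis using g Ag Ae by (simp add: arrow_sum_mult_basis_vector G.arrow_simps)
  qed
  show ?thesis
  proof
    fix f assume "f \<in> carrier B"
    then have "f \<in> carrier basis.BA" by (simp add: B_eq)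
    then show "f \<in> J"
    proof (induction f rule: basis.BA_induct)
      case zero
      show ?case using assms(2) by (simp add: B_eq)
    next
      case (scaled_basis c s)
      then show ?case using smult basis_J by (cases s) (simp add: B_eq)
    next
      case (add f g)
      then show ?case using assms(4) by (simp add: B_eq)
    qed
  qed
qed

end

section \<open>The partial groupoid algebra\<close>

text \<open>
  The half of the universal property of \<open>K\<^sub>p\<^sub>a\<^sub>r(G)\<close> that makes a homomorphism factor through the
  quotient.
\<close>

lemma par_relators_vanish:
  assumes K: "field K" and rep: "partial_representation G M \<sigma>"
    and one: "(\<Oplus>\<^bsub>M\<^esub>e\<in>objects G. \<sigma> e) = \<one>\<^bsub>M\<^esub>"
    and \<Phi>: "\<Phi> \<in> ring_hom (free_algebra K (arrows G)) M"
    and gen: "\<And>g. g \<in> arrows G \<Longrightarrow> \<Phi> (basis_vector K [g]) = \<sigma> g"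
  shows "par_relators K G \<subseteq> a_kernel (free_algebra K (arrows G)) M \<Phi>"
proof -
  interpret partial_representation G M \<sigma> by (rule rep)
  let ?F = "free_algebra K (arrows G)"
  interpret F: assoc_algebra K ?F by (rule assoc_algebra_free_algebra[OF K])
  interpret h: ring_hom_ring ?F M \<Phi>
    by (rule ring_hom_ringI2) (use F.M.ring_axioms M.ring_axioms \<Phi> in auto)
  let ?b = "\<lambda>g. basis_vector K [g]"
  have b: "?b g \<in> carrier ?F" if "g \<in> arrows G" for g using that by (rule basis_vector_closed[OF K])
  have obj: "objects G \<subseteq> arrows G" by (auto simp: objects_def)
  have eq: "x \<ominus>\<^bsub>?F\<^esub> y \<in> a_kernel ?F M \<Phi>" if "x \<in> carrier ?F" "y \<in> carrier ?F" "\<Phi> x = \<Phi> y" for x y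
  proof -
    have "\<Phi> (x \<ominus>\<^bsub>?F\<^esub> y) = \<Phi> x \<oplus>\<^bsub>M\<^esub> \<Phi> (\<ominus>\<^bsub>?F\<^esub> y)"
      unfolding a_minus_def by (rule h.hom_add) (use that in auto)
    also have "\<dots> = \<zero>\<^bsub>M\<^esub>" using that by (simp add: h.hom_a_inv M.r_neg)
    finally show ?thesis
      unfolding a_kernel_def' using F.M.minus_closed[OF that(1,2)] by blast
  qed
  have sum_b: "(\<Oplus>\<^bsub>?F\<^esub>e\<in>objects G. ?b e) \<in> carrier ?F"
    using b obj by (intro F.M.finsum_closed) auto
  have "\<Phi> (\<Oplus>\<^bsub>?F\<^esub>e\<in>objects G. ?b e) = (\<Oplus>\<^bsub>M\<^esub>e\<in>objects G. \<Phi> (?b e))"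
    using b obj by (intro h.hom_finsum) auto
  also have "\<dots> = (\<Oplus>\<^bsub>M\<^esub>e\<in>objects G. \<sigma> e)"
    using obj gen by (intro M.finsum_cong') auto
  finally have \<Phi>_sum: "\<Phi> (\<Oplus>\<^bsub>?F\<^esub>e\<in>objects G. ?b e) = \<one>\<^bsub>M\<^esub>" using one by simp
  have C: "g \<in> arrows G \<and> h \<in> arrows G \<and> gmult G g h \<in> arrows G" if "(g, h) \<in> composable G" for g h
    using that by (auto simp: composable_iff G.arrow_simps)
  have r1: "?b (ginv G g) \<otimes>\<^bsub>?F\<^esub> ?b g \<otimes>\<^bsub>?F\<^esub> ?b h
    \<ominus>\<^bsub>?F\<^esub> ?b (ginv G g) \<otimes>\<^bsub>?F\<^esub> ?b (gmult G g h) \<in> a_kernel ?F M \<Phi>"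
    and r2: "?b g \<otimes>\<^bsub>?F\<^esub> ?b h \<otimes>\<^bsub>?F\<^esub> ?b (ginv G h)
      \<ominus>\<^bsub>?F\<^esub> ?b (gmult G g h) \<otimes>\<^bsub>?F\<^esub> ?b (ginv G h) \<in> a_kernel ?F M \<Phi>"
    if gh: "(g, h) \<in> composable G" for g h
    using C[OF gh] \<sigma>_ginv_mult_mult[OF gh] \<sigma>_mult_mult_ginv[OF gh]
    by (auto intro!: eq simp: b gen G.arrow_simps)
  have r3: "?b (rn G g) \<otimes>\<^bsub>?F\<^esub> ?b g \<ominus>\<^bsub>?F\<^esub> ?b g \<in> a_kernel ?F M \<Phi>"
    and r4: "?b g \<otimes>\<^bsub>?F\<^esub> ?b (dm G g) \<ominus>\<^bsub>?F\<^esub> ?b g \<in> a_kernel ?F M \<Phi>" if "g \<in> arrows G" for g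
    using that by (auto intro!: eq simp: b gen G.arrow_simps \<sigma>_rn \<sigma>_dm)
  have r5: "?b g \<otimes>\<^bsub>?F\<^esub> ?b h \<in> a_kernel ?F M \<Phi>"
    if "(g, h) \<in> (arrows G \<times> arrows G) - composable G" for g h
    unfolding a_kernel_def' using that by (auto simp: b gen intro: \<sigma>_zero)
  have r6: "(\<Oplus>\<^bsub>?F\<^esub>e\<in>objects G. ?b e) \<ominus>\<^bsub>?F\<^esub> \<one>\<^bsub>?F\<^esub> \<in> a_kernel ?F M \<Phi>"
    using sum_b \<Phi>_sum by (intro eq) simp_all
  show ?thesis unfolding par_relators_def Let_def using r1 r2 r3 r4 r5 r6 by blast
qed

lemma quotient_map_ring_hom:
  assumes "ideal I A"
  shows "(\<lambda>a. I +>\<^bsub>A\<^esub> a) \<in> ring_hom A (quot_algebra A I)"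
  using ideal.rcos_ring_hom[OF assms] by (simp add: ring_hom_def quot_algebra_def)

lemma quotient_map_eq_zero_iff:
  assumes "ideal I A" "a \<in> carrier A"
  shows "I +>\<^bsub>A\<^esub> a = \<zero>\<^bsub>quot_algebra A I\<^esub> \<longleftrightarrow> a \<in> I"
proof -
  interpret ideal I A by fact
  show ?thesis
    using assms(2) a_rcos_self[of a] a_coset_join2[OF assms(2) a_subgroup]
    by (auto simp: quot_algebra_def FactRing_def)
qed

lemma partial_representation_quotient:
  fixes K :: "('k, 'm) ring_scheme" and G :: "('g, 'n) precategory_scheme"
  assumes K: "field K" and G: "groupoid G"
  defines "F \<equiv> free_algebra K (arrows G)"
  defines "\<sigma> \<equiv> \<lambda>g. Idl\<^bsub>F\<^esub> (par_relators K G) +>\<^bsub>F\<^esub> basis_vector K [g]"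
  shows "partial_representation G (partial_groupoid_algebra K G) \<sigma>"
    and "(\<Oplus>\<^bsub>partial_groupoid_algebra K G\<^esub>e\<in>objects G. \<sigma> e) = \<one>\<^bsub>partial_groupoid_algebra K G\<^esub>"
proof -
  interpret G: groupoid G by (rule G)
  interpret F: assoc_algebra K F unfolding F_def by (rule assoc_algebra_free_algebra[OF K])
  let ?P = "partial_groupoid_algebra K G" and ?I = "Idl\<^bsub>F\<^esub> (par_relators K G)"
  let ?b = "\<lambda>g. basis_vector K [g]" and ?\<pi> = "\<lambda>f. ?I +>\<^bsub>F\<^esub> f"
  have P: "?P = quot_algebra F ?I" by (simp add: partial_groupoid_algebra_def F_def Let_def)
  interpret P: assoc_algebra K ?P by (rule assoc_algebra_partial_groupoid_algebra[OF K G])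
  have rel_sub: "par_relators K G \<subseteq> carrier F" unfolding F_def by (rule par_relators_subset[OF K G])
  have I: "ideal ?I F" by (rule F.M.genideal_ideal[OF rel_sub])
  interpret h: ring_hom_ring F ?P ?\<pi>
    by (rule ring_hom_ringI2[OF F.M.ring_axioms P.M.ring_axioms])
      (simp add: P quotient_map_ring_hom[OF I])
  have zero: "?\<pi> r = \<zero>\<^bsub>?P\<^esub>" if "r \<in> par_relators K G" for r
    using that quotient_map_eq_zero_iff[OF I, of r] F.M.genideal_self[OF rel_sub] rel_sub P by auto
  have eq: "?\<pi> x = ?\<pi> y" if "x \<ominus>\<^bsub>F\<^esub> y \<in> par_relators K G" "x \<in> carrier F" "y \<in> carrier F" for x y
  proof -
    have "?\<pi> x \<ominus>\<^bsub>?P\<^esub> ?\<pi> y = \<zero>\<^bsub>?P\<^esub>"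
      using zero[OF that(1)] that(2,3) by (simp add: F.M.minus_eq P.M.minus_eq)
    then show ?thesis
      using P.M.add.inv_solve_right[of "\<zero>\<^bsub>?P\<^esub>" "?\<pi> x" "?\<pi> y"] that(2,3) by (simp add: P.M.minus_eq)
  qed
  have b: "?b g \<in> carrier F" if "g \<in> arrows G" for g
    using that unfolding F_def by (rule basis_vector_closed[OF K])
  have obj: "objects G \<subseteq> arrows G" by (auto simp: objects_def)
  have rel:
    "(g, h) \<in> composable G
      \<Longrightarrow> ?b (ginv G g) \<otimes>\<^bsub>F\<^esub> ?b g \<otimes>\<^bsub>F\<^esub> ?b h
        \<ominus>\<^bsub>F\<^esub> ?b (ginv G g) \<otimes>\<^bsub>F\<^esub> ?b (gmult G g h) \<in> par_relators K G"
    "(g, h) \<in> composable G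
      \<Longrightarrow> ?b g \<otimes>\<^bsub>F\<^esub> ?b h \<otimes>\<^bsub>F\<^esub> ?b (ginv G h)
        \<ominus>\<^bsub>F\<^esub> ?b (gmult G g h) \<otimes>\<^bsub>F\<^esub> ?b (ginv G h) \<in> par_relators K G"
    "g \<in> arrows G \<Longrightarrow> ?b (rn G g) \<otimes>\<^bsub>F\<^esub> ?b g \<ominus>\<^bsub>F\<^esub> ?b g \<in> par_relators K G"
    "g \<in> arrows G \<Longrightarrow> ?b g \<otimes>\<^bsub>F\<^esub> ?b (dm G g) \<ominus>\<^bsub>F\<^esub> ?b g \<in> par_relators K G"
    "(g, h) \<in> (arrows G \<times> arrows G) - composable G \<Longrightarrow> ?b g \<otimes>\<^bsub>F\<^esub> ?b h \<in> par_relators K G"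
    "(\<Oplus>\<^bsub>F\<^esub>e\<in>objects G. ?b e) \<ominus>\<^bsub>F\<^esub> \<one>\<^bsub>F\<^esub> \<in> par_relators K G" for g h
    unfolding par_relators_def Let_def F_def by blast+
  show "partial_representation G ?P \<sigma>"
  proof unfold_locales
    fix g h assume gh: "(g, h) \<in> composable G"
    then have a: "g \<in> arrows G" "h \<in> arrows G" "gmult G g h \<in> arrows G"
      "ginv G g \<in> arrows G" "ginv G h \<in> arrows G"
      by (auto simp: composable_def G.ginv_closed intro: G.gmult_closed)
    show "\<sigma> (ginv G g) \<otimes>\<^bsub>?P\<^esub> \<sigma> g \<otimes>\<^bsub>?P\<^esub> \<sigma> h = \<sigma> (ginv G g) \<otimes>\<^bsub>?P\<^esub> \<sigma> (gmult G g h)"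
      using eq[OF rel(1)[OF gh]] a b by (simp add: \<sigma>_def)
    show "\<sigma> g \<otimes>\<^bsub>?P\<^esub> \<sigma> h \<otimes>\<^bsub>?P\<^esub> \<sigma> (ginv G h) = \<sigma> (gmult G g h) \<otimes>\<^bsub>?P\<^esub> \<sigma> (ginv G h)"
      using eq[OF rel(2)[OF gh]] a b by (simp add: \<sigma>_def)
  next
    fix g assume g: "g \<in> arrows G"
    then show "\<sigma> g \<in> carrier ?P" using b by (simp add: \<sigma>_def)
    have "rn G g \<in> arrows G" "dm G g \<in> arrows G" using g by (simp_all add: G.dm_closed G.rn_closed)
    then show "\<sigma> (rn G g) \<otimes>\<^bsub>?P\<^esub> \<sigma> g = \<sigma> g" "\<sigma> g \<otimes>\<^bsub>?P\<^esub> \<sigma> (dm G g) = \<sigma> g"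
      using eq[OF rel(3)[OF g]] eq[OF rel(4)[OF g]] g b by (simp_all add: \<sigma>_def)
  next
    fix g h assume "g \<in> arrows G" "h \<in> arrows G" "(g, h) \<notin> composable G"
    then show "\<sigma> g \<otimes>\<^bsub>?P\<^esub> \<sigma> h = \<zero>\<^bsub>?P\<^esub>" using zero[OF rel(5)[of g h]] b by (simp add: \<sigma>_def)
  qed
  have "(\<Oplus>\<^bsub>?P\<^esub>e\<in>objects G. \<sigma> e) = ?\<pi> (\<Oplus>\<^bsub>F\<^esub>e\<in>objects G. ?b e)"
    unfolding \<sigma>_def using b obj by (intro h.hom_finsum[symmetric]) auto
  also have "\<dots> = ?\<pi> \<one>\<^bsub>F\<^esub>"
    using b obj by (intro eq rel(6) F.M.finsum_closed) auto
  finally show "(\<Oplus>\<^bsub>?P\<^esub>e\<in>objects G. \<sigma> e) = \<one>\<^bsub>?P\<^esub>" by simp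
qed

section \<open>The isomorphism\<close>

context birget_rhodes_algebra
begin

text \<open>
  \<open>\<Phi>\<close> sends \<open>[g]\<close> to \<open>arrow_sum g\<close>, and \<open>\<Psi>\<close> sends the basis vector \<open>(A, g)\<close> to \<open>\<tau> (A, g)\<close>.
  Because \<open>\<Phi>\<close> is onto and its kernel is computed through \<open>\<Psi> \<circ> \<Phi> = \<pi>\<close>, linearity of \<open>\<Psi>\<close> and its
  compatibility with left multiplication by arrow sums suffice: a word is built up from the
  empty word by adding letters on the left.
\<close>

lemma isomorphic_partial_groupoid_algebra:
  "algebra_isomorphic K B (partial_groupoid_algebra K G)"
proof -
  let ?F = "free_algebra K (arrows G)" and ?P = "partial_groupoid_algebra K G"
  let ?b = "basis_vector K" and ?I = "Idl\<^bsub>?F\<^esub> (par_relators K G)"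
  let ?\<pi> = "\<lambda>f. ?I +>\<^bsub>?F\<^esub> f"
  let ?\<sigma> = "\<lambda>g. ?\<pi> (?b [g])"
  have K: "field K" and G: "groupoid G" by unfold_locales
  interpret words: partial_semigroup_basis K "lists (arrows G)" "\<lambda>v w. Some (v @ w)" "{[]}"
    by (rule partial_semigroup_basis_words) (rule K.is_cring)
  have F_eq: "?F = words.BA" by (simp add: free_algebra_def)
  interpret F: assoc_algebra K ?F by (rule assoc_algebra_free_algebra[OF K])
  interpret B: assoc_algebra K B by (rule assoc_algebra_B)
  interpret P: assoc_algebra K ?P by (rule assoc_algebra_partial_groupoid_algebra[OF K G])
  have P: "?P = quot_algebra ?F ?I" by (simp add: partial_groupoid_algebra_def Let_def)
  have rel_sub: "par_relators K G \<subseteq> carrier ?F" by (rule par_relators_subset[OF K G])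
  have I: "ideal ?I ?F" by (rule F.M.genideal_ideal[OF rel_sub])
  have "arrow_sum \<in> arrows G \<rightarrow> carrier B" using arrow_sum_closed by simp
  then obtain \<Phi> where \<Phi>: "\<Phi> \<in> ring_hom ?F B"
    and \<Phi>_smult: "\<And>c f. c \<in> carrier K \<Longrightarrow> f \<in> carrier ?F \<Longrightarrow> \<Phi> (c \<odot>\<^bsub>?F\<^esub> f) = c \<odot>\<^bsub>B\<^esub> \<Phi> f"
    and \<Phi>_word: "\<And>w. w \<in> lists (arrows G) \<Longrightarrow> \<Phi> (?b w) = word_product B arrow_sum w"
    by (rule free_algebra_hom[OF K assoc_algebra_B]) blast
  interpret \<Phi>: ring_hom_ring ?F B \<Phi>
    by (rule ring_hom_ringI2[OF F.M.ring_axioms B.M.ring_axioms \<Phi>])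
  have \<Phi>_gen: "\<Phi> (?b [g]) = arrow_sum g" if "g \<in> arrows G" for g
    using that arrow_sum_closed by (simp add: \<Phi>_word)
  interpret \<pi>: ring_hom_ring ?F ?P ?\<pi>
    by (rule ring_hom_ringI2[OF F.M.ring_axioms P.M.ring_axioms])
      (simp add: P quotient_map_ring_hom[OF I])
  interpret \<sigma>: partial_representation G ?P ?\<sigma> by (rule partial_representation_quotient[OF K G])
  note \<sigma>_one = partial_representation_quotient(2)[OF K G]
  have \<tau>: "\<sigma>.\<tau> \<in> arrows E \<rightarrow> carrier ?P"
    using \<sigma>.\<tau>_closed[OF finite_arrows] by (auto simp: arrow_birget_rhodes_iff)
  let ?\<Psi> = "basis.linear_extension ?P \<sigma>.\<tau>"
  note \<Psi>_simps = basis.linear_extension_smult[OF P.module_axioms \<tau>, folded B_eq]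
    basis.linear_extension_basis_vector[OF P.module_axioms \<tau>]
  interpret \<Psi>: abelian_group_hom B ?P ?\<Psi>
    unfolding B_eq by (rule basis.linear_extension_group_hom[OF P.module_axioms \<tau>])
  have \<Psi>_arrow_sum: "?\<Psi> (arrow_sum g) = ?\<sigma> g" if g: "g \<in> arrows G" for g
  proof -
    let ?X = "{x \<in> arrows E. snd x = g}"
    have "?\<Psi> (arrow_sum g) = (\<Oplus>\<^bsub>?P\<^esub>x\<in>?X. arrow_sum g x \<odot>\<^bsub>?P\<^esub> \<sigma>.\<tau> x)"
      by (rule basis.linear_extension_superset[OF P.module_axioms \<tau>])
        (use arrow_sum_closed supp_arrow_sum finite_arrows_expansion in \<open>simp_all add: B_eq\<close>)
    also have "\<dots> = (\<Oplus>\<^bsub>?P\<^esub>x\<in>?X. \<sigma>.\<tau> x)"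
      using \<tau> by (intro P.M.finsum_cong') (auto simp: arrow_sum_def Pi_def)
    finally show ?thesis using \<sigma>.sum_\<tau>[OF finite_arrows g] by simp
  qed
  have \<Psi>_one: "?\<Psi> \<one>\<^bsub>B\<^esub> = \<one>\<^bsub>?P\<^esub>"
  proof -
    have obj: "objects G \<subseteq> arrows G" by (auto simp: objects_def)
    have "?\<Psi> \<one>\<^bsub>B\<^esub> = (\<Oplus>\<^bsub>?P\<^esub>e\<in>objects G. ?\<Psi> (arrow_sum e))"
      unfolding sum_arrow_sum_objects[symmetric] using arrow_sum_closed by (intro \<Psi>.hom_finsum) auto
    also have "\<dots> = (\<Oplus>\<^bsub>?P\<^esub>e\<in>objects G. ?\<sigma> e)"
      using obj by (intro P.M.finsum_cong') (auto simp: \<Psi>_arrow_sum)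
    finally show ?thesis using \<sigma>_one by simp
  qed
  have \<Psi>_mult: "?\<Psi> (arrow_sum h \<otimes>\<^bsub>B\<^esub> f) = ?\<sigma> h \<otimes>\<^bsub>?P\<^esub> ?\<Psi> f"
    if h: "h \<in> arrows G" and f: "f \<in> carrier B" for h f
    using f unfolding B_eq
  proof (induction f rule: basis.BA_induct)
    case zero
    then show ?case using h arrow_sum_closed by (simp flip: B_eq)
  next
    case (scaled_basis c s)
    obtain A g where s: "s = (A, g)" by fastforce
    have Ag: "(A, g) \<in> arrows E" using scaled_basis s by simp
    have bv: "?b s \<in> carrier B" using basis.basis_vector_in_carrier scaled_basis(2)
      by (simp add: B_eq)
    have \<tau>s: "\<sigma>.\<tau> s \<in> carrier ?P" using \<tau> scaled_basis by auto
    have "?\<Psi> (arrow_sum h \<otimes>\<^bsub>B\<^esub> ?b s) = ?\<sigma> h \<otimes>\<^bsub>?P\<^esub> \<sigma>.\<tau> s"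
      using \<sigma>.\<sigma>_mult_\<tau>[OF finite_arrows h Ag] arrow_sum_mult_basis_vector[OF h Ag]
      by (simp add: s \<Psi>_simps)
    moreover have "?\<Psi> (arrow_sum h \<otimes>\<^bsub>B\<^esub> (c \<odot>\<^bsub>B\<^esub> ?b s)) = c \<odot>\<^bsub>?P\<^esub> ?\<Psi> (arrow_sum h \<otimes>\<^bsub>B\<^esub> ?b s)"
      using scaled_basis bv arrow_sum_closed B.M.m_closed[OF arrow_sum_closed[of h] bv]
      by (simp add: B.smult_mult_right \<Psi>_simps flip: B_eq)
    moreover have "?\<Psi> (c \<odot>\<^bsub>B\<^esub> ?b s) = c \<odot>\<^bsub>?P\<^esub> \<sigma>.\<tau> s"
      using scaled_basis bv by (simp add: \<Psi>_simps)
    ultimately show ?case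
      using scaled_basis h \<tau>s by (simp add: P.smult_mult_right flip: B_eq)
  next
    case (add f g)
    then show ?case using h arrow_sum_closed
      by (simp add: B.M.r_distr P.M.r_distr flip: B_eq)
  qed
  have \<Psi>_word: "?\<Psi> (word_product B arrow_sum w) = ?\<pi> (?b w)" if "w \<in> lists (arrows G)" for w
    using that
  proof (induction w)
    case Nil
    have "?b [] = \<one>\<^bsub>?F\<^esub>"
      by (simp add: free_algebra_def basis_algebra_def basis_vector_def fun_eq_iff)
    then show ?case by (simp add: \<Psi>_one)
  next
    case (Cons g w)
    have w: "word_product B arrow_sum w \<in> carrier B"
      using Cons arrow_sum_closed by (intro B.M.word_product_closed[of _ "arrows G"]) auto
    have "?b (g # w) = ?b [g] \<otimes>\<^bsub>?F\<^esub> ?b w"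
      using Cons words.basis_vector_mult[of "[g]" w] by (simp add: F_eq)
    moreover have "?b [g] \<in> carrier ?F" "?b w \<in> carrier ?F"
      using Cons words.basis_vector_in_carrier by (simp_all add: F_eq)
    ultimately show ?case using Cons w by (simp add: \<Psi>_mult)
  qed
  have \<Psi>_\<Phi>: "?\<Psi> (\<Phi> f) = ?\<pi> f" if f: "f \<in> carrier ?F" for f
    using f unfolding F_eq
  proof (induction f rule: words.BA_induct)
    case zero
    then show ?case by (simp flip: F_eq)
  next
    case (scaled_basis c w)
    then have "?b w \<in> carrier ?F" using words.basis_vector_in_carrier by (simp add: F_eq)
    moreover from this have "\<Phi> (?b w) \<in> carrier B" by (rule \<Phi>.hom_closed)
    moreover have "?\<pi> (c \<odot>\<^bsub>?F\<^esub> ?b w) = c \<odot>\<^bsub>?P\<^esub> ?\<pi> (?b w)"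
      using quot_algebra_smult_coset[OF F.assoc_algebra_axioms I] scaled_basis calculation(1) P by simp
    ultimately show ?case
      using scaled_basis \<Psi>_word by (simp add: \<Phi>_smult \<Phi>_word \<Psi>_simps flip: F_eq)
  next
    case (add f g)
    then show ?case by (simp flip: F_eq)
  qed
  have ker: "a_kernel ?F B \<Phi> = ?I"
  proof
    show "?I \<subseteq> a_kernel ?F B \<Phi>"
      using \<Phi>.kernel_is_ideal
        par_relators_vanish[OF K partial_representation_arrow_sum sum_arrow_sum_objects \<Phi> \<Phi>_gen]
      by (rule F.M.genideal_minimal)
    show "a_kernel ?F B \<Phi> \<subseteq> ?I"
    proof
      fix f assume "f \<in> a_kernel ?F B \<Phi>"
      then have f: "f \<in> carrier ?F" and "\<Phi> f = \<zero>\<^bsub>B\<^esub>" unfolding a_kernel_def' by blast+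
      then have "?\<pi> f = \<zero>\<^bsub>?P\<^esub>" using \<Psi>_\<Phi>[OF f] by simp
      then show "f \<in> ?I" using quotient_map_eq_zero_iff[OF I f] P by simp
    qed
  qed
  have surj: "carrier B \<subseteq> \<Phi> ` carrier ?F"
  proof (rule arrow_sums_generate)
    have b: "?b [g] \<in> carrier ?F" if "g \<in> arrows G" for g using that
      by (rule basis_vector_closed[OF K])
    show gens: "arrow_sum g \<in> \<Phi> ` carrier ?F" if "g \<in> arrows G" for g
      using that b \<Phi>_gen by (metis imageI)
    show "\<zero>\<^bsub>B\<^esub> \<in> \<Phi> ` carrier ?F" using \<Phi>.hom_zero F.M.zero_closed by (metis imageI)
    show "x \<oplus>\<^bsub>B\<^esub> y \<in> \<Phi> ` carrier ?F" if "x \<in> \<Phi> ` carrier ?F" "y \<in> \<Phi> ` carrier ?F" for x y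
      using that by (auto simp flip: \<Phi>.hom_add)
    show "c \<odot>\<^bsub>B\<^esub> x \<in> \<Phi> ` carrier ?F" if "c \<in> carrier K" "x \<in> \<Phi> ` carrier ?F" for c x
      using that by (auto simp flip: \<Phi>_smult)
    show "arrow_sum g \<otimes>\<^bsub>B\<^esub> x \<in> \<Phi> ` carrier ?F" if "g \<in> arrows G" "x \<in> \<Phi> ` carrier ?F" for g x
      using gens[OF that(1)] that(2) by (auto simp flip: \<Phi>.hom_mult)
  qed auto
  show ?thesis
    unfolding P using F.assoc_algebra_axioms B.M.ring_axioms \<Phi> \<Phi>_smult surj ker
    by (rule algebra_isomorphic_quot_algebra)
qed

end

theorem corollary3p3:
  fixes K :: "('k, 'm) ring_scheme"
    and G :: "('g, 'n) precategory_scheme"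
  assumes "field K"
    and "groupoid G"
    and "finite (arrows G)"
  shows "algebra_isomorphic K
    (groupoid_algebra K (birget_rhodes G)) (partial_groupoid_algebra K G)"
proof -
  interpret birget_rhodes_algebra K G
    using assms by (simp add: birget_rhodes_algebra_def birget_rhodes_algebra_axioms_def)
  show ?thesis by (rule isomorphic_partial_groupoid_algebra)
qed

end
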